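(* For all $b\le0$, $1\le r\le\frac43$ and $1\le p,q\le\infty$ the estimate $$\|\mathbf T(u_1,u_2,u_3)\|_{X^{\frac12,b}_{r,p}}\lesssim\prod_{i=1}^3\|u_i\|_{X^{\frac12,\frac12}_{r,q}}$$ is false; that is, there is no constant $C$ such that $\|\mathbf T(u_1,u_2,u_3)\|_{X^{\frac12,b}_{r,p}}\le C\prod_{i=1}^3\|u_i\|_{X^{\frac12,\frac12}_{r,q}}$ holds for all $u_1,u_2,u_3\in X^{\frac12,\frac12}_{r,q}$.
   Context: $\mathbb T=\mathbb R/2\pi\mathbb Z$, $\langle\xi\rangle=(1+\xi^2)^{1/2}$; primes denote dual exponents, $\frac1p+\frac1{p'}=1$. For functions $u(t,x)$ on $\mathbb R\times\mathbb T$, $\widehat u(\xi)$ denotes the partial Fourier transform in $x$, $\widehat f(\xi)=\frac{1}{\sqrt{2\pi}}\int_0^{2\pi}f(x)e^{-ix\xi}dx$, $\xi\in\mathbb Z$ ($t$ suppressed), and $\mathcal Fu(\tau,\xi)$ the Fourier transform in $t$ and $x$. $X^{s,b}_{r,p}$ ($s,b\in\mathbb R$, $1\le r,p\le\infty$) is the completion of the space of smooth functions on $\mathbb R\times\mathbb T$ that are, together with all derivatives, rapidly decreasing in $t$, with respect to the norm $$\|u\|_{X^{s,b}_{r,p}}=\|\langle\tau+\xi^2\rangle^b\langle\xi\rangle^s\mathcal Fu(\tau,\xi)\|_{\ell^{r'}_\xi L^{p'}_\tau}.$$ The trilinear operator $\mathbf T$ is defined by $$\widehat{\mathbf T(u_1,u_2,u_3)}(\xi)=(2\pi)^{-1}\sum_{\substack{\xi=\xi_1+\xi_2+\xi_3\\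 \xi_1\neq\xi,\ \xi_2\ne\xi}}\widehat u_1(\xi_1)\widehat u_2(\xi_2)\,i\xi_3\,\widehat{\overline u}_3(\xi_3)+(2\pi)^{-1}\widehat u_1(\xi)\widehat u_2(\xi)\,i\xi\,\widehat{\overline u}_3(-\xi).$$ *)

theory Defs
  imports "HOL-Analysis.Analysis" "HOL-Probability.Essential_Supremum"
begin

section \<open>Mixed Lebesgue norms with exponents in [1, infinity]\<close>

definition dual_exponent :: "ennreal \<Rightarrow> ennreal" where
  "dual_exponent p = inverse (1 - inverse p)"

lemma dual_exponent:
  assumes "1 \<le> p"
  shows "inverse p + inverse (dual_exponent p) = 1"
proof -
  have le: "inverse p \<le> 1"
    using assms by (cases p) (auto simp: inverse_ennreal field_simps)
  have inv: "inverse (inverse x) = x" for x :: ennreal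
    by (cases x; cases "x = 0") (auto simp: inverse_ennreal less_le)
  show ?thesis
    unfolding dual_exponent_def inv using le by (rule add_diff_inverse_ennreal)
qed

text \<open>Powers of extended nonnegative reals; only used for exponents \<open>a > 0\<close>.\<close>

definition epowr :: "ennreal \<Rightarrow> real \<Rightarrow> ennreal" where
  "epowr x a = (if x = top then top else ennreal (enn2real x powr a))"

definition Lp_norm :: "'a measure \<Rightarrow> ennreal \<Rightarrow> ('a \<Rightarrow> ennreal) \<Rightarrow> ennreal" where
  "Lp_norm M p f =
     (if p = top then esssup M f
      else epowr (\<integral>\<^sup>+ x. epowr (f x) (enn2real p) \<partial>M) (1 / enn2real p))"

section \<open>Functions on the line times the circle and their Fourier transforms\<close>

text \<open>
  A function on \<open>\<real> \<times> \<T>\<close> is a function \<open>u t x\<close> that is \<open>2 * pi\<close>-periodic in \<open>x\<close>.  In the following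
  definition \<open>D j k\<close> is the mixed partial derivative of order \<open>j\<close> in \<open>t\<close> and \<open>k\<close> in \<open>x\<close>; since all of
  them are required to exist and to be jointly continuous, \<open>u\<close> is smooth.
\<close>

definition test_functions :: "(real \<Rightarrow> real \<Rightarrow> complex) set" where
  "test_functions = {u. (\<forall>t x. u t (x + 2 * pi) = u t x) \<and>
     (\<exists>D :: nat \<Rightarrow> nat \<Rightarrow> real \<Rightarrow> real \<Rightarrow> complex. D 0 0 = u \<and>
        (\<forall>j k. continuous_on UNIV (\<lambda>(t, x). D j k t x)) \<and>
        (\<forall>j k t x. ((\<lambda>s. D j k s x) has_vector_derivative D (Suc j) k t x) (at t)) \<and>
        (\<forall>j k t x. ((\<lambda>y. D j k t y) has_vector_derivative D j (Suc k) t x) (at x)) \<and>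
        (\<forall>j k N. \<exists>B. \<forall>t x. \<bar>t\<bar> ^ N * cmod (D j k t x) \<le> B))}"

definition fourier_x :: "(real \<Rightarrow> real \<Rightarrow> complex) \<Rightarrow> real \<Rightarrow> int \<Rightarrow> complex" where
  "fourier_x u t \<xi> =
     of_real (1 / sqrt (2 * pi)) *
     (LINT x:{0..2 * pi}|lborel. u t x * exp (- (\<i> * of_real x * of_int \<xi>)))"

definition fourier_tx :: "(real \<Rightarrow> real \<Rightarrow> complex) \<Rightarrow> real \<Rightarrow> int \<Rightarrow> complex" where
  "fourier_tx u \<tau> \<xi> =
     of_real (1 / sqrt (2 * pi)) *
     (LINT t|lborel. fourier_x u t \<xi> * exp (- (\<i> * of_real t * of_real \<tau>)))"

definition jbracket :: "real \<Rightarrow> real" where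
  "jbracket y = sqrt (1 + y\<^sup>2)"

section \<open>The spaces X\<close>

definition X_prenorm ::
  "real \<Rightarrow> real \<Rightarrow> ennreal \<Rightarrow> ennreal \<Rightarrow> (real \<Rightarrow> real \<Rightarrow> complex) \<Rightarrow> ennreal" where
  "X_prenorm s b r p u =
     Lp_norm (count_space (UNIV :: int set)) (dual_exponent r)
       (\<lambda>\<xi>. Lp_norm lborel (dual_exponent p)
         (\<lambda>\<tau>. ennreal (jbracket (\<tau> + (of_int \<xi>)\<^sup>2) powr b * jbracket (of_int \<xi>) powr s *
                       cmod (fourier_tx u \<tau> \<xi>))))"

text \<open>
  The completion of the test functions is the set of Cauchy sequences modulo sequences that tend
  to zero; its norm is the limit of the norms along any representing sequence.
\<close>

definition X_Cauchy ::
  "real \<Rightarrow> real \<Rightarrow> ennreal \<Rightarrow> ennreal \<Rightarrow> (nat \<Rightarrow> real \<Rightarrow> real \<Rightarrow> complex) set" where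
  "X_Cauchy s b r p = {v. (\<forall>n. v n \<in> test_functions) \<and>
     (\<forall>e>0. \<exists>M. \<forall>m\<ge>M. \<forall>n\<ge>M. X_prenorm s b r p (\<lambda>t x. v m t x - v n t x) < ennreal e)}"

definition X_rel ::
  "real \<Rightarrow> real \<Rightarrow> ennreal \<Rightarrow> ennreal \<Rightarrow>
     ((nat \<Rightarrow> real \<Rightarrow> real \<Rightarrow> complex) \<times> (nat \<Rightarrow> real \<Rightarrow> real \<Rightarrow> complex)) set" where
  "X_rel s b r p = {(v, w). v \<in> X_Cauchy s b r p \<and> w \<in> X_Cauchy s b r p \<and>
     (\<lambda>n. X_prenorm s b r p (\<lambda>t x. v n t x - w n t x)) \<longlonglongrightarrow> 0}"

definition X_space ::
  "real \<Rightarrow> real \<Rightarrow> ennreal \<Rightarrow> ennreal \<Rightarrow> (nat \<Rightarrow> real \<Rightarrow> real \<Rightarrow> complex) set set" where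
  "X_space s b r p = X_Cauchy s b r p // X_rel s b r p"

definition X_norm ::
  "real \<Rightarrow> real \<Rightarrow> ennreal \<Rightarrow> ennreal \<Rightarrow> (nat \<Rightarrow> real \<Rightarrow> real \<Rightarrow> complex) set \<Rightarrow> ennreal" where
  "X_norm s b r p U = (THE l. \<forall>v\<in>U. (\<lambda>n. X_prenorm s b r p (v n)) \<longlonglongrightarrow> l)"

section \<open>The trilinear operator\<close>

text \<open>In the sum, \<open>\<xi>\<^sub>3 = \<xi> - \<xi>\<^sub>1 - \<xi>\<^sub>2\<close>.\<close>

definition T_hat ::
  "(real \<Rightarrow> real \<Rightarrow> complex) \<Rightarrow> (real \<Rightarrow> real \<Rightarrow> complex) \<Rightarrow> (real \<Rightarrow> real \<Rightarrow> complex) \<Rightarrow>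
     real \<Rightarrow> int \<Rightarrow> complex" where
  "T_hat u1 u2 u3 t \<xi> =
     of_real (1 / (2 * pi)) *
       (\<Sum>\<^sub>\<infinity>(\<xi>1, \<xi>2)\<in>{(\<xi>1, \<xi>2). \<xi>1 \<noteq> \<xi> \<and> \<xi>2 \<noteq> \<xi>}.
          fourier_x u1 t \<xi>1 * fourier_x u2 t \<xi>2 *
          (\<i> * of_int (\<xi> - \<xi>1 - \<xi>2)) * fourier_x (\<lambda>t x. cnj (u3 t x)) t (\<xi> - \<xi>1 - \<xi>2)) +
     of_real (1 / (2 * pi)) *
       (fourier_x u1 t \<xi> * fourier_x u2 t \<xi> * (\<i> * of_int \<xi>) *
        fourier_x (\<lambda>t x. cnj (u3 t x)) t (- \<xi>))"

text \<open>
  On test functions the coefficients \<open>T_hat\<close> decrease rapidly in \<open>\<xi>\<close>, so they are the Fourier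
  coefficients of the following absolutely convergent Fourier series.
\<close>

definition T_op ::
  "(real \<Rightarrow> real \<Rightarrow> complex) \<Rightarrow> (real \<Rightarrow> real \<Rightarrow> complex) \<Rightarrow> (real \<Rightarrow> real \<Rightarrow> complex) \<Rightarrow>
     real \<Rightarrow> real \<Rightarrow> complex" where
  "T_op u1 u2 u3 t x =
     of_real (1 / sqrt (2 * pi)) *
     (\<Sum>\<^sub>\<infinity>\<xi>\<in>UNIV. T_hat u1 u2 u3 t \<xi> * exp (\<i> * of_real x * of_int \<xi>))"

text \<open>
  \<open>T_estimate s b r p s' b' r' p' C\<close>: the estimate
  \<open>\<parallel>T (u1, u2, u3)\<parallel> \<le> C * \<parallel>u1\<parallel> * \<parallel>u2\<parallel> * \<parallel>u3\<parallel>\<close> for all \<open>u1, u2, u3\<close> in \<open>X_space s b r p\<close>, with the norm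
  of \<open>X_space s' b' r' p'\<close> on the left.  The operator is given on test functions only; on the
  completion it means the extension by continuity \<open>TT\<close>, which maps the classes of three Cauchy
  sequences to the class of the sequence of their images.  By trilinearity, if the inequality
  holds for test functions, then \<open>TT\<close> exists and satisfies it, so requiring \<open>TT\<close> to exist adds
  nothing to the estimate.
\<close>

definition T_estimate ::
  "real \<Rightarrow> real \<Rightarrow> ennreal \<Rightarrow> ennreal \<Rightarrow> real \<Rightarrow> real \<Rightarrow> ennreal \<Rightarrow> ennreal \<Rightarrow> real \<Rightarrow> bool" where
  "T_estimate s b r p s' b' r' p' C \<longleftrightarrow>
     (\<exists>TT. \<forall>U1\<in>X_space s b r p. \<forall>U2\<in>X_space s b r p. \<forall>U3\<in>X_space s b r p.
        TT U1 U2 U3 \<in> X_space s' b' r' p' \<and>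
        (\<forall>u1\<in>U1. \<forall>u2\<in>U2. \<forall>u3\<in>U3. (\<lambda>n. T_op (u1 n) (u2 n) (u3 n)) \<in> TT U1 U2 U3) \<and>
        X_norm s' b' r' p' (TT U1 U2 U3)
          \<le> ennreal C * X_norm s b r p U1 * X_norm s b r p U2 * X_norm s b r p U3)"

end

theory Submission
  imports Defs "HOL-Probability.Characteristic_Functions" "HOL-Probability.Sinc_Integral"
begin

text \<open>
  Apart from the diagonal term \<open>\<xi>1 = \<xi>2 = \<xi>\<close>, which vanishes at output frequency \<open>\<xi> = 0\<close>, the trilinear
  operator has only non-resonant interactions.  They carry the modulation
  \<open>\<xi>\<^sup>2 - \<xi>1\<^sup>2 - \<xi>2\<^sup>2 + \<xi>3\<^sup>2 = 2 (\<xi> - \<xi>1) (\<xi> - \<xi>2)\<close>.  If one input absorbs it, the norms gain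
  the square root of this product, which for \<open>\<xi> = 0\<close>, \<open>\<xi>2 = 1\<close>, \<open>\<xi>1 = n\<close>, \<open>\<xi>3 = - n - 1\<close> is a factor of size
  \<open>n\<^bsup>-1/2\<^esup>\<close>.  The derivative falls on the third input and costs \<open>n\<close>, while the weights
  \<open>\<langle>\<xi>1\<rangle>\<^bsup>1/2\<^esup>\<close> and \<open>\<langle>\<xi>3\<rangle>\<^bsup>1/2\<^esup>\<close> give back \<open>n\<^bsup>-1\<^esup>\<close>.  After normalisation the output at frequency 0 is therefore
  \<open>\<Sum> n\<^bsup>-1/2\<^esup> f n * h n\<close>, where \<open>f\<close> and \<open>h\<close> are measured in the sequence norm of exponent \<open>r'\<close>.  For
  \<open>r \<le> 4 / 3\<close> one has \<open>r' \<ge> 4\<close>, and \<open>f n = h n = n\<^bsup>-1/4\<^esup>\<close> for \<open>n \<le> N\<close> is at or beyond the endpoint: the sum is the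
  harmonic number \<open>H\<close> of \<open>N\<close>, but the two norms are at most \<open>H\<^bsup>1/4\<^esup>\<close> each.  An estimate
  would give \<open>H \<le> C * H\<^bsup>1/2\<^esup>\<close> for all \<open>N\<close>, contradicting the divergence of the harmonic series.

  The inputs are Gaussian wave packets, whose Fourier transforms are explicit.  Upper bounds for their
  norms come from \<open>X_prenorm_wave_packet_le\<close>, the output is computed in \<open>T_hat_inputs\<close>, and
  \<open>X_prenorm_T_op_inputs_ge\<close> bounds its norm from below.  The output is tested at one
  frequency and for bounded modulation, so that \<open>b\<close> and \<open>p\<close> enter its lower bound only through a
  constant.

  The estimate speaks about the completion.  It is transferred to test functions by
  \<open>T_estimate_test_functions\<close>, which rests on the triangle inequality for the mixed Lebesgue norm: it
  shows that the norm of the class of a constant sequence is the norm of its entry.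
\<close>

section \<open>Mixed Lebesgue norms\<close>

lemma epowr_mono: "x \<le> y \<Longrightarrow> 0 \<le> a \<Longrightarrow> epowr x a \<le> epowr y a"
  unfolding epowr_def
  by (auto simp: top_unique intro!: ennreal_leI powr_mono2 enn2real_mono simp: less_top)

lemma epowr_ennreal: "0 \<le> x \<Longrightarrow> epowr (ennreal x) a = ennreal (x powr a)"
  unfolding epowr_def by simp

lemma epowr_0: "epowr 0 a = 0"
  unfolding epowr_def by simp

lemma epowr_epowr_inverse: "0 < a \<Longrightarrow> epowr (epowr x a) (1 / a) = x"
  by (cases x) (auto simp: epowr_ennreal powr_powr, auto simp: epowr_def)

lemma measurable_epowr [measurable]:
  assumes "f \<in> borel_measurable M"
  shows "(\<lambda>x. epowr (f x) a) \<in> borel_measurable M"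
  unfolding epowr_def using assms by measurable

lemma Lp_norm_mono:
  assumes "f \<in> borel_measurable M" and "\<And>x. f x \<le> g x"
  shows "Lp_norm M p f \<le> Lp_norm M p g"
  unfolding Lp_norm_def using assms
  by (auto intro!: esssup_mono epowr_mono nn_integral_mono)

lemma Lp_norm_0:
  assumes "1 \<le> p"
  shows "Lp_norm M p (\<lambda>_. 0) = 0"
proof -
  have "esssup M (\<lambda>_. 0 :: ennreal) \<le> 0" by (rule esssup_I) auto
  then show ?thesis by (simp add: Lp_norm_def epowr_0)
qed

lemma enn2real_exponent_ge:
  assumes "ennreal m \<le> p" "p \<noteq> top" "0 \<le> m"
  shows "m \<le> enn2real p"
  using assms by (metis enn2real_ennreal enn2real_mono less_top)

text \<open>
  This is convexity of \<open>x powr p\<close> applied to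
  \<open>(x + y) / (a + b) = \<theta> * (x / a) + (1 - \<theta>) * (y / b)\<close> with \<open>\<theta> = a / (a + b)\<close>.  When \<open>a\<close> and \<open>b\<close>
  are the norms of two functions, integrating it gives the triangle inequality.
\<close>

lemma powr_sum_le:
  fixes x y a b p :: real
  assumes "0 \<le> x" "0 \<le> y" "0 < a" "0 < b" "1 \<le> p"
  shows "(x + y) powr p \<le> (a + b) powr (p - 1) * (a powr (1 - p) * x powr p + b powr (1 - p) * y powr p)"
proof -
  define \<theta> where "\<theta> = a / (a + b)"
  have \<theta>: "0 < \<theta>" "0 < 1 - \<theta>" using assms by (auto simp: \<theta>_def field_simps)
  have 1: "1 - \<theta> = b / (a + b)" using assms by (auto simp: \<theta>_def field_simps)
  have small: "(s * z) powr p \<le> s * z powr p" if "0 < s" "s < 1" "0 \<le> z" for s z :: real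
  proof -
    have "(s * z) powr p = s powr p * z powr p" using that by (simp add: powr_mult)
    also have "s powr p \<le> s powr 1" using that assms by (intro powr_mono') auto
    finally show ?thesis using that by (simp add: mult_right_mono)
  qed
  \<comment> \<open>\<open>powr_convex\<close> concerns the open half line; an argument \<open>0\<close> is treated separately.\<close>
  have conv: "(\<theta> * u + (1 - \<theta>) * v) powr p \<le> \<theta> * u powr p + (1 - \<theta>) * v powr p" if "0 \<le> u" "0 \<le> v" for u v
  proof (cases "u = 0 \<or> v = 0")
    case True
    then show ?thesis using small[of \<theta> u] small[of "1 - \<theta>" v] \<theta> that assms by auto
  next
    case False
    then show ?thesis
      using convex_onD[OF powr_convex[OF assms(5)], of "1 - \<theta>" u v] \<theta> that by auto
  qed
  have xy: "x + y = (a + b) * (\<theta> * (x / a) + (1 - \<theta>) * (y / b))"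
  proof -
    have "\<theta> * (x / a) = x / (a + b)" "(1 - \<theta>) * (y / b) = y / (a + b)"
      unfolding 1 using assms by (simp_all add: \<theta>_def)
    then show ?thesis using assms by (simp add: add_divide_distrib[symmetric])
  qed
  have "(x + y) powr p = (a + b) powr p * (\<theta> * (x / a) + (1 - \<theta>) * (y / b)) powr p"
    unfolding xy by (rule powr_mult)
  also have "\<dots> \<le> (a + b) powr p * (\<theta> * (x / a) powr p + (1 - \<theta>) * (y / b) powr p)"
    using conv[of "x / a" "y / b"] assms by (intro mult_left_mono) auto
  also have "\<dots> = (a + b) powr (p - 1) * (a powr (1 - p) * x powr p + b powr (1 - p) * y powr p)"
  proof -
    have "\<theta> * (x / a) powr p = a powr (1 - p) * x powr p / (a + b)"
      using assms by (simp add: \<theta>_def powr_divide powr_diff)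
    moreover have "(1 - \<theta>) * (y / b) powr p = b powr (1 - p) * y powr p / (a + b)"
      unfolding 1 using assms by (simp add: powr_divide powr_diff)
    moreover have "(a + b) powr (p - 1) = (a + b) powr p / (a + b)"
      using assms by (simp add: powr_diff)
    ultimately show ?thesis by (simp add: add_divide_distrib distrib_left)
  qed
  finally show ?thesis .
qed

text \<open>
  The triangle inequality must hold with constant 1: in the completion the norm of a class is a
  limit of norms, and only the sharp inequality makes the norm continuous.
\<close>

lemma Lp_norm_triangle:
  assumes [measurable]: "f \<in> borel_measurable M" "g \<in> borel_measurable M" and "1 \<le> p"
  shows "Lp_norm M p (\<lambda>x. f x + g x) \<le> Lp_norm M p f + Lp_norm M p g"
proof (cases "p = top")
  case True
  have "AE x in M. f x + g x \<le> esssup M f + esssup M g"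
    using esssup_AE[of f M] esssup_AE[of g M] by eventually_elim (rule add_mono)
  then show ?thesis using True by (auto simp: Lp_norm_def intro!: esssup_I)
next
  case False
  define P where "P = enn2real p"
  have P: "1 \<le> P" using enn2real_exponent_ge[of 1 p] assms False by (simp add: P_def)
  have norm_def: "Lp_norm M p h = epowr (\<integral>\<^sup>+ x. epowr (h x) P \<partial>M) (1 / P)" for h
    using False by (simp add: Lp_norm_def P_def)
  have int_le: "(\<integral>\<^sup>+ x. epowr (h x) P \<partial>M) \<le> ennreal (c powr P)"
    if "Lp_norm M p h \<le> ennreal c" "0 \<le> c" for h c
  proof -
    have "(\<integral>\<^sup>+ x. epowr (h x) P \<partial>M) = epowr (Lp_norm M p h) P"
      unfolding norm_def using epowr_epowr_inverse[of "1 / P"] P by simp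
    also have "\<dots> \<le> epowr (ennreal c) P" using that P by (intro epowr_mono) auto
    finally show ?thesis using that by (simp add: epowr_ennreal)
  qed
  \<comment> \<open>Strict upper bounds \<open>a\<close>, \<open>b\<close> in place of the norms avoid dividing by a vanishing norm.\<close>
  have le: "Lp_norm M p (\<lambda>x. f x + g x) \<le> ennreal (a + b)"
    if "Lp_norm M p f \<le> ennreal a" "Lp_norm M p g \<le> ennreal b" "0 < a" "0 < b" for a b
  proof -
    have pw: "epowr (f x + g x) P \<le> ennreal ((a + b) powr (P - 1)) *
      (ennreal (a powr (1 - P)) * epowr (f x) P + ennreal (b powr (1 - P)) * epowr (g x) P)" for x
    proof (cases "f x = top \<or> g x = top")
      case True
      then show ?thesis using that
        by (auto simp: epowr_def ennreal_mult_top ennreal_top_mult)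
    next
      case False
      then obtain u v where uv: "f x = ennreal u" "g x = ennreal v" "0 \<le> u" "0 \<le> v"
        by (metis ennreal_cases)
      show ?thesis using powr_sum_le[of u v a b P] that uv P
        by (simp add: epowr_ennreal ennreal_plus[symmetric] ennreal_mult[symmetric] del: ennreal_plus)
    qed
    have "(\<integral>\<^sup>+ x. epowr (f x + g x) P \<partial>M) \<le> (\<integral>\<^sup>+ x. ennreal ((a + b) powr (P - 1)) *
      (ennreal (a powr (1 - P)) * epowr (f x) P + ennreal (b powr (1 - P)) * epowr (g x) P) \<partial>M)"
      by (intro nn_integral_mono pw)
    also have "\<dots> = ennreal ((a + b) powr (P - 1)) *
      (ennreal (a powr (1 - P)) * (\<integral>\<^sup>+ x. epowr (f x) P \<partial>M) + ennreal (b powr (1 - P)) * (\<integral>\<^sup>+ x. epowr (g x) P \<partial>M))"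
      by (simp add: nn_integral_cmult nn_integral_add)
    also have "\<dots> \<le> ennreal ((a + b) powr (P - 1)) *
      (ennreal (a powr (1 - P)) * ennreal (a powr P) + ennreal (b powr (1 - P)) * ennreal (b powr P))"
      using that by (intro mult_left_mono add_mono int_le) auto
    also have "\<dots> = ennreal ((a + b) powr P)"
    proof -
      have "a powr (1 - P) * a powr P = a" "b powr (1 - P) * b powr P = b"
        using that by (simp_all add: powr_add[symmetric])
      moreover have "(a + b) powr (P - 1) * (a + b) = (a + b) powr P"
        using that powr_add[of "a + b" "P - 1" 1] by simp
      ultimately show ?thesis using that
        by (simp add: ennreal_plus[symmetric] ennreal_mult[symmetric] del: ennreal_plus)
    qed
    finally have "Lp_norm M p (\<lambda>x. f x + g x) \<le> epowr (ennreal ((a + b) powr P)) (1 / P)"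
      unfolding norm_def using P by (intro epowr_mono) auto
    then show ?thesis using that P by (simp add: epowr_ennreal powr_powr)
  qed
  show ?thesis
  proof (cases "Lp_norm M p f = top \<or> Lp_norm M p g = top")
    case True
    then show ?thesis by auto
  next
    case False
    then obtain a b where ab: "Lp_norm M p f = ennreal a" "Lp_norm M p g = ennreal b" "0 \<le> a" "0 \<le> b"
      by (metis ennreal_cases)
    show ?thesis
    proof (rule ennreal_le_epsilon)
      fix e :: real assume "0 < e"
      then have "Lp_norm M p (\<lambda>x. f x + g x) \<le> ennreal ((a + e / 2) + (b + e / 2))"
        using ab by (intro le) (auto intro!: ennreal_leI)
      then show "Lp_norm M p (\<lambda>x. f x + g x) \<le> Lp_norm M p f + Lp_norm M p g + ennreal e"
        using ab \<open>0 < e\<close> by (simp add: ennreal_plus[symmetric] add_ac del: ennreal_plus)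
    qed
  qed
qed

text \<open>
  A set of measure at least 1 makes the bound independent of the exponent.  It serves both for a
  single frequency in the counting measure and for the unit interval of the variable \<open>\<tau>\<close>.
\<close>

lemma Lp_norm_ge:
  assumes [measurable]: "f \<in> borel_measurable M" "A \<in> sets M"
    and A: "1 \<le> emeasure M A" and ge: "\<And>x. x \<in> A \<Longrightarrow> ennreal c \<le> f x" and "0 \<le> c" "1 \<le> p"
  shows "ennreal c \<le> Lp_norm M p f"
proof (cases "p = top")
  case True
  show ?thesis
  proof (rule ccontr)
    assume "\<not> ennreal c \<le> Lp_norm M p f"
    then have lt: "esssup M f < ennreal c" using True by (simp add: Lp_norm_def)
    have "AE x in M. x \<notin> A"
      using esssup_AE[of f M] by eventually_elim (use ge lt in force)
    then have "emeasure M A = 0" by (subst (asm) AE_iff_measurable[of A]) (use sets.sets_into_space[OF assms(2)] in auto)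
    then show False using A by simp
  qed
next
  case False
  define P where "P = enn2real p"
  have P: "1 \<le> P" using enn2real_exponent_ge[of 1 p] assms False by (simp add: P_def)
  have "ennreal (c powr P) * 1 \<le> ennreal (c powr P) * emeasure M A" using A by (intro mult_left_mono) auto
  also have "\<dots> = (\<integral>\<^sup>+ x. ennreal (c powr P) * indicator A x \<partial>M)"
    by (simp add: nn_integral_cmult_indicator)
  also have "\<dots> \<le> (\<integral>\<^sup>+ x. epowr (f x) P \<partial>M)"
    using epowr_mono[OF ge] P \<open>0 \<le> c\<close> by (intro nn_integral_mono) (auto simp: indicator_def epowr_ennreal)
  finally have "epowr (ennreal (c powr P)) (1 / P) \<le> epowr (\<integral>\<^sup>+ x. epowr (f x) P \<partial>M) (1 / P)"
    using P by (intro epowr_mono) auto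
  then show ?thesis using False P \<open>0 \<le> c\<close> by (simp add: Lp_norm_def P_def epowr_ennreal powr_powr)
qed

text \<open>
  Because \<open>g \<le> 1\<close>, an integral bound for the power \<open>m\<close> controls every larger power, and because
  \<open>1 \<le> G\<close> the root \<open>1 / m\<close> dominates the root \<open>1 / p\<close>.  This treats all exponents \<open>p \<ge> m\<close>,
  infinity included, at once: \<open>m = 1\<close> is used in \<open>\<tau>\<close> and \<open>m = 4\<close> in the frequency.
\<close>

lemma Lp_norm_le:
  assumes [measurable]: "f \<in> borel_measurable M" "g \<in> borel_measurable M"
    and le: "\<And>x. f x \<le> ennreal (K * g x)" and g: "\<And>x. 0 \<le> g x" "\<And>x. g x \<le> 1"
    and G: "(\<integral>\<^sup>+ x. ennreal (g x powr m) \<partial>M) \<le> ennreal G"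
    and "1 \<le> G" "0 \<le> K" "1 \<le> m" "ennreal m \<le> p"
  shows "Lp_norm M p f \<le> ennreal (K * G powr (1 / m))"
proof (cases "p = top")
  case True
  have "f x \<le> ennreal (K * G powr (1 / m))" for x
  proof -
    have "g x \<le> G powr (1 / m)" using g(2)[of x] ge_one_powr_ge_zero[of G "1 / m"] assms
      by (auto intro: order_trans[OF g(2)])
    then show ?thesis using le[of x] \<open>0 \<le> K\<close>
      by (meson ennreal_leI mult_left_mono order_trans)
  qed
  then show ?thesis using True by (auto simp: Lp_norm_def intro!: esssup_I)
next
  case False
  define P where "P = enn2real p"
  have P: "m \<le> P" using enn2real_exponent_ge[of m p] assms False by (simp add: P_def)
  have "(\<integral>\<^sup>+ x. epowr (f x) P \<partial>M) \<le> (\<integral>\<^sup>+ x. ennreal (K powr P) * ennreal (g x powr m) \<partial>M)"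
  proof (rule nn_integral_mono)
    fix x
    have "epowr (f x) P \<le> ennreal ((K * g x) powr P)"
      using epowr_mono[OF le[of x], of P] P assms by (simp add: epowr_ennreal)
    also have "(K * g x) powr P \<le> K powr P * g x powr m"
      using g[of x] P assms by (simp add: powr_mult mult_left_mono powr_mono')
    finally show "epowr (f x) P \<le> ennreal (K powr P) * ennreal (g x powr m)"
      by (simp add: ennreal_mult[symmetric] ennreal_leI)
  qed
  also have "\<dots> = ennreal (K powr P) * (\<integral>\<^sup>+ x. ennreal (g x powr m) \<partial>M)"
    by (intro nn_integral_cmult) auto
  also have "\<dots> \<le> ennreal (K powr P) * ennreal G" by (intro mult_left_mono G) auto
  also have "\<dots> = ennreal (K powr P * G)" using assms by (simp add: ennreal_mult)
  finally have "Lp_norm M p f \<le> epowr (ennreal (K powr P * G)) (1 / P)"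
    using False P assms by (auto simp: Lp_norm_def P_def intro!: epowr_mono)
  also have "\<dots> = ennreal (K * G powr (1 / P))"
    using P assms by (simp add: epowr_ennreal powr_mult powr_powr)
  also have "\<dots> \<le> ennreal (K * G powr (1 / m))"
    using P assms by (intro ennreal_leI mult_left_mono powr_mono) (auto simp: field_simps)
  finally show ?thesis .
qed

lemma inverse_antimono_ennreal: "(x :: ennreal) \<le> y \<Longrightarrow> inverse y \<le> inverse x"
  by (cases x; cases y; cases "x = 0"; cases "y = 0")
    (auto simp: inverse_ennreal top_unique less_le intro!: ennreal_leI)

lemma dual_exponent_ge_1: "1 \<le> p \<Longrightarrow> 1 \<le> dual_exponent p"
proof -
  have "inverse (1::ennreal) \<le> inverse (1 - inverse p)"
    by (intro inverse_antimono_ennreal) auto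
  then show ?thesis by (simp add: dual_exponent_def)
qed

text \<open>
  The exponent \<open>4 / 3\<close> is critical because its dual is 4, the exponent for which the sequence
  \<open>n\<^bsup>-1/4\<^esup>\<close> just fails to have a finite norm.
\<close>

lemma dual_exponent_ge_4:
  assumes "1 \<le> r" "r \<le> 4 / 3"
  shows "ennreal 4 \<le> dual_exponent r"
proof -
  have "(4 / 3 :: ennreal) = ennreal 4 / ennreal 3" by simp
  also have "\<dots> = ennreal (4 / 3)" by (rule divide_ennreal) auto
  finally have "4 / 3 = ennreal (4 / 3)" .
  with assms obtain x where x: "r = ennreal x" "1 \<le> x" "x \<le> 4 / 3"
    by (cases r) (auto simp: top_unique)
  have "1 - inverse r = ennreal (1 - inverse x)"
    using x by (simp add: inverse_ennreal ennreal_1[symmetric] ennreal_minus del: ennreal_1)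
  also have "\<dots> \<le> ennreal (1 / 4)" using x by (intro ennreal_leI) (auto simp: field_simps)
  finally have "inverse (ennreal (1 / 4)) \<le> dual_exponent r"
    unfolding dual_exponent_def by (rule inverse_antimono_ennreal)
  then show ?thesis by (simp add: inverse_ennreal)
qed

section \<open>Fourier transforms of test functions\<close>

lemma fourier_x_measurable:
  assumes "u \<in> test_functions"
  shows "(\<lambda>t. fourier_x u t \<xi>) \<in> borel_measurable borel"
proof -
  have "continuous_on UNIV (\<lambda>(t, x). u t x)"
    using assms unfolding test_functions_def by auto
  then have [measurable]: "(\<lambda>p. u (fst p) (snd p)) \<in> borel_measurable (borel \<Otimes>\<^sub>M borel)"
    by (simp add: borel_prod split_beta borel_measurable_continuous_onI)
  show ?thesis
    unfolding fourier_x_def set_lebesgue_integral_def by measurable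
qed

lemma test_function_continuous_x:
  assumes "u \<in> test_functions"
  shows "continuous_on UNIV (u t)"
proof -
  have "continuous_on UNIV (\<lambda>(t, x). u t x)"
    using assms unfolding test_functions_def by auto
  then have "continuous_on UNIV (\<lambda>x. (\<lambda>(t, x). u t x) (t, x))"
    by (rule continuous_on_compose2) (auto intro!: continuous_intros)
  then show ?thesis by simp
qed

lemma test_function_decay:
  assumes "u \<in> test_functions"
  obtains B where "\<And>t x. cmod (u t x) \<le> B / (1 + t\<^sup>2)"
proof -
  from assms obtain D :: "nat \<Rightarrow> nat \<Rightarrow> real \<Rightarrow> real \<Rightarrow> complex" where D: "D 0 0 = u"
    and *: "\<And>j k N. \<exists>B. \<forall>t x. \<bar>t\<bar> ^ N * cmod (D j k t x) \<le> B"
    unfolding test_functions_def by blast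
  obtain B0 B2 where "\<And>t x. \<bar>t\<bar> ^ 0 * cmod (u t x) \<le> B0" "\<And>t x. \<bar>t\<bar> ^ 2 * cmod (u t x) \<le> B2"
    using *[of 0 0 0] *[of 2 0 0] D by metis
  then have "(1 + t\<^sup>2) * cmod (u t x) \<le> B0 + B2" for t x
    by (simp add: distrib_right add_mono)
  moreover have "0 < 1 + t\<^sup>2" for t :: real by (simp add: add_pos_nonneg)
  ultimately have "cmod (u t x) \<le> (B0 + B2) / (1 + t\<^sup>2)" for t x
    by (simp add: pos_le_divide_eq mult.commute)
  then show ?thesis by (rule that)
qed

lemma fourier_x_set_integrable:
  assumes "continuous_on UNIV f"
  shows "set_integrable lborel {0..2 * pi} (\<lambda>x. f x * exp (- (\<i> * of_real x * of_int \<xi>)) :: complex)"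
  by (rule borel_integrable_atLeastAtMost')
    (intro continuous_intros continuous_on_subset[OF assms], auto)

lemma fourier_x_decay:
  assumes "u \<in> test_functions"
  obtains B where "\<And>t. cmod (fourier_x u t \<xi>) \<le> B / (1 + t\<^sup>2)"
proof -
  obtain B where B: "\<And>t x. cmod (u t x) \<le> B / (1 + t\<^sup>2)"
    using test_function_decay[OF assms] by blast
  have "cmod (fourier_x u t \<xi>) \<le> (1 / sqrt (2 * pi) * (2 * pi) * B) / (1 + t\<^sup>2)" for t
  proof -
    have "cmod (LINT x:{0..2 * pi}|lborel. u t x * exp (- (\<i> * of_real x * of_int \<xi>)))
      \<le> (LINT x:{0..2 * pi}|lborel. B / (1 + t\<^sup>2))"
      unfolding set_lebesgue_integral_def
    proof (rule Bochner_Integration.integral_norm_bound_integral)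
      show "integrable lborel (\<lambda>x. indicat_real {0..2 * pi} x *\<^sub>R (u t x * exp (- (\<i> * of_real x * of_int \<xi>))))"
        using fourier_x_set_integrable[OF test_function_continuous_x[OF assms]]
        by (simp add: set_integrable_def)
      show "integrable lborel (\<lambda>x. indicat_real {0..2 * pi} x *\<^sub>R (B / (1 + t\<^sup>2)))"
        using borel_integrable_atLeastAtMost'[of 0 "2 * pi" "\<lambda>_. B / (1 + t\<^sup>2)"]
        by (simp add: set_integrable_def)
      fix x
      have "cmod (exp (- (\<i> * of_real x * of_int \<xi>))) = 1" by (simp add: norm_exp_eq_Re)
      then show "norm (indicat_real {0..2 * pi} x *\<^sub>R (u t x * exp (- (\<i> * of_real x * of_int \<xi>))))
        \<le> indicat_real {0..2 * pi} x *\<^sub>R (B / (1 + t\<^sup>2))"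
        using B[of t x] by (simp add: norm_mult indicator_def)
    qed
    also have "\<dots> = 2 * pi * (B / (1 + t\<^sup>2))"
      by (simp add: set_lebesgue_integral_def)
    finally have "cmod (LINT x:{0..2 * pi}|lborel. u t x * exp (- (\<i> * of_real x * of_int \<xi>)))
      \<le> 2 * pi * (B / (1 + t\<^sup>2))" .
    then have "1 / sqrt (2 * pi) * cmod (LINT x:{0..2 * pi}|lborel. u t x * exp (- (\<i> * of_real x * of_int \<xi>)))
      \<le> 1 / sqrt (2 * pi) * (2 * pi * (B / (1 + t\<^sup>2)))"
      by (intro mult_left_mono) auto
    then show ?thesis by (simp add: fourier_x_def norm_mult norm_divide real_sqrt_mult)
  qed
  then show ?thesis by (rule that)
qed

lemma integrable_inverse_one_plus_square: "integrable lborel (\<lambda>t::real. B / (1 + t\<^sup>2))"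
  using integrable_mult_right[OF integrable_inverse_1_plus_square[unfolded set_integrable_def], of B]
  by (simp add: divide_inverse)

lemma fourier_x_integrable:
  assumes "u \<in> test_functions"
  shows "integrable lborel (\<lambda>t. fourier_x u t \<xi> * exp (- (\<i> * of_real t * of_real \<tau>)))"
proof -
  obtain B where B: "\<And>t. cmod (fourier_x u t \<xi>) \<le> B / (1 + t\<^sup>2)"
    using fourier_x_decay[OF assms] by blast
  have [measurable]: "(\<lambda>t. fourier_x u t \<xi>) \<in> borel_measurable borel"
    by (rule fourier_x_measurable[OF assms])
  show ?thesis
  proof (rule Bochner_Integration.integrable_bound[OF integrable_inverse_one_plus_square[of B]])
    show "AE t in lborel. norm (fourier_x u t \<xi> * exp (- (\<i> * of_real t * of_real \<tau>))) \<le> norm (B / (1 + t\<^sup>2))"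
    proof (intro AE_I2)
      fix t
      have "cmod (exp (- (\<i> * of_real t * of_real \<tau>))) = 1" by (simp add: norm_exp_eq_Re)
      then show "norm (fourier_x u t \<xi> * exp (- (\<i> * of_real t * of_real \<tau>))) \<le> norm (B / (1 + t\<^sup>2))"
        using order_trans[OF B[of t], of "\<bar>B\<bar> / (1 + t\<^sup>2)"] by (simp add: norm_mult divide_right_mono)
    qed
  qed measurable
qed

lemma fourier_tx_measurable:
  assumes "u \<in> test_functions"
  shows "(\<lambda>\<tau>. fourier_tx u \<tau> \<xi>) \<in> borel_measurable borel"
proof -
  have [measurable]: "(\<lambda>t. fourier_x u t \<xi>) \<in> borel_measurable borel"
    by (rule fourier_x_measurable[OF assms])
  show ?thesis unfolding fourier_tx_def by measurable
qed

lemma fourier_tx_diff: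
  assumes "u \<in> test_functions" "v \<in> test_functions"
  shows "fourier_tx (\<lambda>t x. u t x - v t x) \<tau> \<xi> = fourier_tx u \<tau> \<xi> - fourier_tx v \<tau> \<xi>"
proof -
  have "fourier_x (\<lambda>t x. u t x - v t x) t \<xi> = fourier_x u t \<xi> - fourier_x v t \<xi>" for t
    unfolding fourier_x_def left_diff_distrib
    using assms by (subst set_integral_diff(2))
      (auto intro!: fourier_x_set_integrable test_function_continuous_x simp: right_diff_distrib)
  then show ?thesis
    unfolding fourier_tx_def
    using fourier_x_integrable[OF assms(1)] fourier_x_integrable[OF assms(2)]
    by (simp add: left_diff_distrib right_diff_distrib)
qed

text \<open>
  The norm of \<open>X\<close> as a function of the Fourier transform, where it is a mixed Lebesgue norm and the
  triangle inequality can be applied without reference to \<open>u\<close>.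
\<close>

definition weighted_norm :: "real \<Rightarrow> real \<Rightarrow> ennreal \<Rightarrow> ennreal \<Rightarrow> (real \<Rightarrow> int \<Rightarrow> complex) \<Rightarrow> ennreal" where
  "weighted_norm s b r p F =
     Lp_norm (count_space (UNIV :: int set)) (dual_exponent r)
       (\<lambda>\<xi>. Lp_norm lborel (dual_exponent p)
         (\<lambda>\<tau>. ennreal (jbracket (\<tau> + (of_int \<xi>)\<^sup>2) powr b * jbracket (of_int \<xi>) powr s * cmod (F \<tau> \<xi>))))"

lemma X_prenorm_eq: "X_prenorm s b r p u = weighted_norm s b r p (fourier_tx u)"
  by (simp add: X_prenorm_def weighted_norm_def)

lemma jbracket_measurable [measurable]: "jbracket \<in> borel_measurable borel"
  unfolding jbracket_def by measurable

lemma weighted_norm_triangle: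
  assumes [measurable]: "\<And>\<xi>. (\<lambda>\<tau>. F \<tau> \<xi>) \<in> borel_measurable borel" "\<And>\<xi>. (\<lambda>\<tau>. G \<tau> \<xi>) \<in> borel_measurable borel"
    "\<And>\<xi>. (\<lambda>\<tau>. H \<tau> \<xi>) \<in> borel_measurable borel"
    and le: "\<And>\<tau> \<xi>. cmod (F \<tau> \<xi>) \<le> cmod (G \<tau> \<xi>) + cmod (H \<tau> \<xi>)" and "1 \<le> r" "1 \<le> p"
  shows "weighted_norm s b r p F \<le> weighted_norm s b r p G + weighted_norm s b r p H"
proof -
  define w where "w \<tau> \<xi> = jbracket (\<tau> + (of_int \<xi>)\<^sup>2) powr b * jbracket (of_int \<xi>) powr s" for \<tau> and \<xi> :: int
  have [measurable]: "\<And>\<xi>. (\<lambda>\<tau>. w \<tau> \<xi>) \<in> borel_measurable borel" unfolding w_def by measurable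
  define I where "I K \<xi> = Lp_norm lborel (dual_exponent p) (\<lambda>\<tau>. ennreal (w \<tau> \<xi> * cmod (K \<tau> \<xi>)))"
    for K :: "real \<Rightarrow> int \<Rightarrow> complex" and \<xi>
  have norm_eq: "weighted_norm s b r p K = Lp_norm (count_space UNIV) (dual_exponent r) (I K)" for K
    unfolding weighted_norm_def I_def w_def ..
  have "I F \<xi> \<le> I G \<xi> + I H \<xi>" for \<xi>
  proof -
    have "I F \<xi> \<le> Lp_norm lborel (dual_exponent p)
      (\<lambda>\<tau>. ennreal (w \<tau> \<xi> * cmod (G \<tau> \<xi>)) + ennreal (w \<tau> \<xi> * cmod (H \<tau> \<xi>)))"
      unfolding I_def
    proof (rule Lp_norm_mono)
      fix \<tau>
      have "0 \<le> w \<tau> \<xi>" by (simp add: w_def)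
      then show "ennreal (w \<tau> \<xi> * cmod (F \<tau> \<xi>)) \<le> ennreal (w \<tau> \<xi> * cmod (G \<tau> \<xi>)) + ennreal (w \<tau> \<xi> * cmod (H \<tau> \<xi>))"
        using le[of \<tau> \<xi>] by (simp add: ennreal_plus[symmetric] distrib_left[symmetric] ennreal_leI mult_left_mono del: ennreal_plus)
    qed measurable
    also have "\<dots> \<le> I G \<xi> + I H \<xi>"
      unfolding I_def using assms by (intro Lp_norm_triangle dual_exponent_ge_1) measurable
    finally show ?thesis .
  qed
  then have "weighted_norm s b r p F \<le> Lp_norm (count_space UNIV) (dual_exponent r) (\<lambda>\<xi>. I G \<xi> + I H \<xi>)"
    unfolding norm_eq by (intro Lp_norm_mono) auto
  also have "\<dots> \<le> weighted_norm s b r p G + weighted_norm s b r p H"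
    unfolding norm_eq using assms by (intro Lp_norm_triangle dual_exponent_ge_1) auto
  finally show ?thesis .
qed

text \<open>
  The differences are oriented as they occur when two sequences \<open>u\<close>, \<open>w\<close> are related to the same
  representative \<open>v\<close>.
\<close>

lemma X_prenorm_triangle:
  assumes "u \<in> test_functions" "v \<in> test_functions" "w \<in> test_functions" "1 \<le> r" "1 \<le> p"
  shows "X_prenorm s b r p (\<lambda>t x. u t x - w t x)
    \<le> X_prenorm s b r p (\<lambda>t x. v t x - u t x) + X_prenorm s b r p (\<lambda>t x. v t x - w t x)"
  unfolding X_prenorm_eq
proof (rule weighted_norm_triangle)
  fix \<tau> \<xi>
  show "cmod (fourier_tx (\<lambda>t x. u t x - w t x) \<tau> \<xi>)
    \<le> cmod (fourier_tx (\<lambda>t x. v t x - u t x) \<tau> \<xi>) + cmod (fourier_tx (\<lambda>t x. v t x - w t x) \<tau> \<xi>)"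
    using norm_triangle_ineq4[of "fourier_tx v \<tau> \<xi> - fourier_tx w \<tau> \<xi>" "fourier_tx v \<tau> \<xi> - fourier_tx u \<tau> \<xi>"] assms
    by (simp add: fourier_tx_diff)
qed (use assms in \<open>auto simp: fourier_tx_diff fourier_tx_measurable intro!: borel_measurable_diff\<close>)

lemma X_prenorm_le_add_diff:
  assumes "u \<in> test_functions" "v \<in> test_functions" "1 \<le> r" "1 \<le> p"
  shows "X_prenorm s b r p u \<le> X_prenorm s b r p v + X_prenorm s b r p (\<lambda>t x. u t x - v t x)"
    and "X_prenorm s b r p u \<le> X_prenorm s b r p v + X_prenorm s b r p (\<lambda>t x. v t x - u t x)"
proof -
  have "cmod (fourier_tx u \<tau> \<xi>) \<le> cmod (fourier_tx v \<tau> \<xi>) + cmod (fourier_tx u \<tau> \<xi> - fourier_tx v \<tau> \<xi>)" for \<tau> \<xi>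
    by (rule norm_triangle_sub)
  then show "X_prenorm s b r p u \<le> X_prenorm s b r p v + X_prenorm s b r p (\<lambda>t x. u t x - v t x)"
    "X_prenorm s b r p u \<le> X_prenorm s b r p v + X_prenorm s b r p (\<lambda>t x. v t x - u t x)"
    unfolding X_prenorm_eq using assms
    by (auto intro!: weighted_norm_triangle borel_measurable_diff simp: fourier_tx_diff fourier_tx_measurable)
      (simp add: norm_minus_commute)
qed

section \<open>Reduction from the completion to test functions\<close>

lemma X_prenorm_0:
  assumes "1 \<le> r" "1 \<le> p"
  shows "X_prenorm s b r p (\<lambda>t x. 0) = 0"
  using assms by (simp add: X_prenorm_def fourier_tx_def fourier_x_def Lp_norm_0 dual_exponent_ge_1)

lemma constant_sequence_in_X_space:
  assumes "u \<in> test_functions" "1 \<le> r" "1 \<le> p"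
  obtains U where "U \<in> X_space s b r p" "(\<lambda>_. u) \<in> U"
proof
  have C: "(\<lambda>_. u) \<in> X_Cauchy s b r p"
    using assms by (auto simp: X_Cauchy_def X_prenorm_0)
  then show "X_rel s b r p `` {\<lambda>_. u} \<in> X_space s b r p"
    unfolding X_space_def by (rule quotientI)
  show "(\<lambda>_. u) \<in> X_rel s b r p `` {\<lambda>_. u}"
    using C assms by (simp add: X_rel_def X_prenorm_0)
qed

lemma constant_sequence_test_function:
  assumes "U \<in> X_space s b r p" "(\<lambda>_. u) \<in> U"
  shows "u \<in> test_functions"
  using assms by (auto simp: X_space_def quotient_def X_rel_def X_Cauchy_def)

text \<open>
  All representatives of a class have the same limit of norms by the triangle inequality, and the
  constant sequence identifies this limit.  The norm of \<open>u\<close> may be infinite here; this matters for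
  the image under the trilinear operator, about whose norm nothing is known beforehand.
\<close>

lemma X_norm_constant_sequence:
  assumes "U \<in> X_space s b r p" "(\<lambda>_. u) \<in> U" "1 \<le> r" "1 \<le> p"
  shows "X_norm s b r p U = X_prenorm s b r p u"
proof -
  have u: "u \<in> test_functions" using constant_sequence_test_function[OF assms(1,2)] .
  have lim: "(\<lambda>n. X_prenorm s b r p (v n)) \<longlonglongrightarrow> X_prenorm s b r p u" if "v \<in> U" for v
  proof -
    obtain v0 where "U = X_rel s b r p `` {v0}" using assms(1) unfolding X_space_def by (auto elim: quotientE)
    then have rel: "(v0, v) \<in> X_rel s b r p" "(v0, \<lambda>_. u) \<in> X_rel s b r p" using that assms(2) by auto
    then have v: "v n \<in> test_functions" "v0 n \<in> test_functions" for n by (auto simp: X_rel_def X_Cauchy_def)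
    let ?d = "\<lambda>n. X_prenorm s b r p (\<lambda>t x. v n t x - u t x)"
    have d: "?d \<longlonglongrightarrow> 0"
    proof (rule tendsto_sandwich[OF _ _ tendsto_const])
      show "(\<lambda>n. X_prenorm s b r p (\<lambda>t x. v0 n t x - v n t x) + X_prenorm s b r p (\<lambda>t x. v0 n t x - u t x)) \<longlonglongrightarrow> 0"
      proof -
        have "(\<lambda>n. X_prenorm s b r p (\<lambda>t x. v0 n t x - v n t x)) \<longlonglongrightarrow> 0"
          and "(\<lambda>n. X_prenorm s b r p (\<lambda>t x. v0 n t x - u t x)) \<longlonglongrightarrow> 0"
          using rel by (simp_all add: X_rel_def)
        from tendsto_add[OF this] show ?thesis by simp
      qed
      show "\<forall>\<^sub>F n in sequentially. ?d n \<le> X_prenorm s b r p (\<lambda>t x. v0 n t x - v n t x) + X_prenorm s b r p (\<lambda>t x. v0 n t x - u t x)"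
        using X_prenorm_triangle u v assms by auto
    qed auto
    have d_finite: "\<forall>\<^sub>F n in sequentially. ?d n < top"
      using order_tendstoD(2)[OF d, of top] by simp
    show ?thesis
    proof (rule tendsto_sandwich)
      show "\<forall>\<^sub>F n in sequentially. X_prenorm s b r p u - ?d n \<le> X_prenorm s b r p (v n)"
        using d_finite
      proof eventually_elim
        case (elim n)
        then show ?case
          using X_prenorm_le_add_diff(2)[of u "v n" r p s b] u v assms
          by (auto simp: ennreal_minus_le_iff add.commute)
      qed
      show "\<forall>\<^sub>F n in sequentially. X_prenorm s b r p (v n) \<le> X_prenorm s b r p u + ?d n"
        using X_prenorm_le_add_diff(1)[of "v _" u r p s b] u v assms by auto
      show "(\<lambda>n. X_prenorm s b r p u + ?d n) \<longlonglongrightarrow> X_prenorm s b r p u"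
        using tendsto_add[OF tendsto_const d, of "X_prenorm s b r p u"] by simp
      show "(\<lambda>n. X_prenorm s b r p u - ?d n) \<longlonglongrightarrow> X_prenorm s b r p u"
      \<comment> \<open>Subtraction on \<open>ennreal\<close> is discontinuous at \<open>top - top\<close>, so an infinite norm needs its own argument.\<close>
      proof (cases "X_prenorm s b r p u = top")
        case True
        have "\<forall>\<^sub>F n in sequentially. X_prenorm s b r p u - ?d n = X_prenorm s b r p u"
          using d_finite by eventually_elim (use True in \<open>auto simp: ennreal_top_minus\<close>)
        then show ?thesis by (rule tendsto_eventually)
      next
        case False
        then show ?thesis using tendsto_diff_ennreal[OF tendsto_const d False] by simp
      qed
    qed
  qed
  show ?thesis
    unfolding X_norm_def
  proof (rule the_equality)
    show "\<forall>v\<in>U. (\<lambda>n. X_prenorm s b r p (v n)) \<longlonglongrightarrow> X_prenorm s b r p u" using lim by blast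
    fix l assume "\<forall>v\<in>U. (\<lambda>n. X_prenorm s b r p (v n)) \<longlonglongrightarrow> l"
    then have "(\<lambda>n::nat. X_prenorm s b r p u) \<longlonglongrightarrow> l" using assms(2) by (rule bspec)
    then show "l = X_prenorm s b r p u" by (simp add: tendsto_const_iff)
  qed
qed

text \<open>
  Constant sequences embed the test functions into the completion.  That \<open>T_op u1 u2 u3\<close> is itself a
  test function comes from the estimate, since the class \<open>TT U1 U2 U3\<close> consists of sequences of test
  functions and contains the constant sequence of \<open>T_op u1 u2 u3\<close>.
\<close>

lemma T_estimate_test_functions:
  assumes "T_estimate s b r p s' b' r' p' C"
    and "u1 \<in> test_functions" "u2 \<in> test_functions" "u3 \<in> test_functions"
    and "1 \<le> r" "1 \<le> p" "1 \<le> r'" "1 \<le> p'"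
  shows "X_prenorm s' b' r' p' (T_op u1 u2 u3)
    \<le> ennreal C * X_prenorm s b r p u1 * X_prenorm s b r p u2 * X_prenorm s b r p u3"
proof -
  from assms(1) obtain TT where TT: "\<forall>U1\<in>X_space s b r p. \<forall>U2\<in>X_space s b r p. \<forall>U3\<in>X_space s b r p.
        TT U1 U2 U3 \<in> X_space s' b' r' p' \<and>
        (\<forall>u1\<in>U1. \<forall>u2\<in>U2. \<forall>u3\<in>U3. (\<lambda>n. T_op (u1 n) (u2 n) (u3 n)) \<in> TT U1 U2 U3) \<and>
        X_norm s' b' r' p' (TT U1 U2 U3)
          \<le> ennreal C * X_norm s b r p U1 * X_norm s b r p U2 * X_norm s b r p U3"
    unfolding T_estimate_def by (elim exE)
  obtain U1 where U1: "U1 \<in> X_space s b r p" "(\<lambda>_. u1) \<in> U1"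
    by (rule constant_sequence_in_X_space[OF assms(2,5,6)])
  obtain U2 where U2: "U2 \<in> X_space s b r p" "(\<lambda>_. u2) \<in> U2"
    by (rule constant_sequence_in_X_space[OF assms(3,5,6)])
  obtain U3 where U3: "U3 \<in> X_space s b r p" "(\<lambda>_. u3) \<in> U3"
    by (rule constant_sequence_in_X_space[OF assms(4,5,6)])
  note T = TT[THEN bspec, OF U1(1), THEN bspec, OF U2(1), THEN bspec, OF U3(1)]
  have "(\<lambda>_. T_op u1 u2 u3) \<in> TT U1 U2 U3"
    by (rule T[THEN conjunct2, THEN conjunct1, THEN bspec, OF U1(2), THEN bspec, OF U2(2), THEN bspec, OF U3(2)])
  then have "X_norm s' b' r' p' (TT U1 U2 U3) = X_prenorm s' b' r' p' (T_op u1 u2 u3)"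
    by (rule X_norm_constant_sequence[OF T[THEN conjunct1] _ assms(7,8)])
  then show ?thesis
    using T X_norm_constant_sequence[OF U1 assms(5,6)] X_norm_constant_sequence[OF U2 assms(5,6)]
      X_norm_constant_sequence[OF U3 assms(5,6)]
    by (elim conjE) (simp only:)
qed

section \<open>Trigonometric polynomials and Gaussians\<close>

lemma integral_exp_int:
  "(LINT x:{0..2 * pi}|lborel. exp (\<i> * of_real x * of_int k)) = (if k = 0 then of_real (2 * pi) else 0)"
proof (cases "k = 0")
  case True
  then show ?thesis by (simp add: set_lebesgue_integral_def scaleR_conv_of_real)
next
  case False
  define F where "F x = exp (\<i> * of_real x * of_int k) / (\<i> * of_int k)" for x :: real
  have "((\<lambda>z. exp (\<i> * z * of_int k) / (\<i> * of_int k)) has_field_derivative exp (\<i> * of_real x * of_int k)) (at (of_real x))"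
    for x :: real
    using False by (auto intro!: derivative_eq_intros)
  from has_vector_derivative_real_field[OF this]
  have F': "(F has_vector_derivative exp (\<i> * of_real x * of_int k)) (at x within {0..2 * pi})" for x
    unfolding F_def by (auto intro: has_vector_derivative_at_within)
  have "F (2 * pi) = F 0"
  proof -
    have "exp (\<i> * of_real (2 * pi) * of_int k) = (1 :: complex)"
      using exp_integer_2pi[of "of_int k"] by (simp add: mult_ac)
    then show ?thesis by (simp add: F_def)
  qed
  moreover have "(LINT x:{0..2 * pi}|lborel. exp (\<i> * of_real x * of_int k)) = F (2 * pi) - F 0"
    unfolding set_lebesgue_integral_def
    by (rule integral_FTC_Icc) (auto intro!: F' continuous_intros)
  ultimately show ?thesis using False by simp
qed

lemma fourier_x_trig_polynomial:
  assumes "finite B"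
  shows "fourier_x (\<lambda>t x. \<Sum>n\<in>B. h t n * exp (\<i> * of_real x * of_int n)) t \<xi>
    = (if \<xi> \<in> B then of_real (sqrt (2 * pi)) * h t \<xi> else 0)"
proof -
  have int: "set_integrable lborel {0..2 * pi} (\<lambda>x. exp (\<i> * of_real x * of_int k) :: complex)" for k
    by (rule borel_integrable_atLeastAtMost') (intro continuous_intros)
  have "(LINT x:{0..2 * pi}|lborel. (\<Sum>n\<in>B. h t n * exp (\<i> * of_real x * of_int n)) * exp (- (\<i> * of_real x * of_int \<xi>)))
    = (LINT x:{0..2 * pi}|lborel. (\<Sum>n\<in>B. h t n * exp (\<i> * of_real x * of_int (n - \<xi>))))"
    by (simp add: sum_distrib_right mult.assoc exp_add[symmetric] right_diff_distrib)
  also have "\<dots> = (\<Sum>n\<in>B. LINT x:{0..2 * pi}|lborel. h t n * exp (\<i> * of_real x * of_int (n - \<xi>)))"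
    unfolding set_lebesgue_integral_def scaleR_sum_right
    using int unfolding set_integrable_def
    by (intro Bochner_Integration.integral_sum) (auto simp: mult_scaleR_right[symmetric] simp del: mult_scaleR_right of_int_diff)
  also have "\<dots> = (\<Sum>n\<in>B. h t n * (if n = \<xi> then of_real (2 * pi) else 0))"
    by (simp only: set_integral_mult_right integral_exp_int right_minus_eq)
  also have "\<dots> = (if \<xi> \<in> B then h t \<xi> * of_real (2 * pi) else 0)"
    using assms by (simp add: if_distrib[of "(*) _"] sum.delta' cong: if_cong)
  finally have integral: "(LINT x:{0..2 * pi}|lborel. (\<Sum>n\<in>B. h t n * exp (\<i> * of_real x * of_int n)) * exp (- (\<i> * of_real x * of_int \<xi>)))
    = (if \<xi> \<in> B then h t \<xi> * of_real (2 * pi) else 0)" .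
  have "of_real (1 / sqrt (2 * pi)) * complex_of_real (2 * pi) = of_real (sqrt (2 * pi))"
    by (simp only: of_real_mult[symmetric]) (simp add: real_div_sqrt)
  then have "of_real (1 / sqrt (2 * pi)) * (h t \<xi> * complex_of_real (2 * pi)) = of_real (sqrt (2 * pi)) * h t \<xi>"
    by (metis mult.left_commute mult.commute)
  then show ?thesis unfolding fourier_x_def integral by (simp del: of_real_mult)
qed

lemma fourier_x_cnj: "fourier_x (\<lambda>t x. cnj (u t x)) t \<xi> = cnj (fourier_x u t (- \<xi>))"
proof -
  have eq: "indicat_real {0..2 * pi} x *\<^sub>R (cnj (u t x) * exp (- (\<i> * of_real x * of_int \<xi>)))
    = cnj (indicat_real {0..2 * pi} x *\<^sub>R (u t x * exp (- (\<i> * of_real x * of_int (- \<xi>)))))" for x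
    by (simp add: exp_cnj)
  then show ?thesis
    unfolding fourier_x_def set_lebesgue_integral_def
    by (simp only: eq Bochner_Integration.integral_cnj complex_cnj_mult complex_cnj_complex_of_real)
qed

text \<open>
  The case \<open>a = 1\<close> is the characteristic function of the standard normal distribution; the general
  case follows by scaling.
\<close>

lemma gaussian_fourier:
  assumes "0 < a"
  shows "(LINT t|lborel. exp (\<i> * of_real (s * t) - of_real (a * t\<^sup>2 / 2)))
    = of_real (sqrt (2 * pi / a) * exp (- (s\<^sup>2 / (2 * a))))"
proof -
  have std: "(LINT t|lborel. exp (\<i> * of_real (s * t) - of_real (t\<^sup>2 / 2))) = of_real (sqrt (2 * pi) * exp (- (s\<^sup>2 / 2)))" for s
  proof -
    have "of_real (exp (- (s\<^sup>2) / 2)) = (CLINT t|std_normal_distribution. exp (\<i> * of_real (s * t)))"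
      using fun_cong[OF char_std_normal_distribution, of s] unfolding char_def by (rule sym)
    also have "\<dots> = (LINT t|lborel. std_normal_density t *\<^sub>R exp (\<i> * of_real (s * t)))"
      by (rule integral_density) auto
    also have "\<dots> = (LINT t|lborel. of_real (1 / sqrt (2 * pi)) * exp (\<i> * of_real (s * t) - of_real (t\<^sup>2 / 2)))"
    proof (rule Bochner_Integration.integral_cong[OF refl])
      fix t :: real
      have "exp (\<i> * of_real (s * t) - of_real (t\<^sup>2 / 2)) = exp (\<i> * of_real (s * t)) * exp (of_real (- t\<^sup>2 / 2))"
        by (simp add: exp_add[symmetric])
      then show "std_normal_density t *\<^sub>R exp (\<i> * of_real (s * t)) =
          of_real (1 / sqrt (2 * pi)) * exp (\<i> * of_real (s * t) - of_real (t\<^sup>2 / 2))"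
        unfolding exp_of_real std_normal_density_def scaleR_conv_of_real of_real_mult by (simp only: mult_ac)
    qed
    also have "\<dots> = of_real (1 / sqrt (2 * pi)) * (LINT t|lborel. exp (\<i> * of_real (s * t) - of_real (t\<^sup>2 / 2)))"
      by simp
    finally have e: "of_real (exp (- (s\<^sup>2) / 2)) = of_real (1 / sqrt (2 * pi)) * (LINT t|lborel. exp (\<i> * of_real (s * t) - of_real (t\<^sup>2 / 2)))" .
    have "R \<noteq> 0 \<Longrightarrow> of_real R * (of_real (1 / R) * I) = I" for R and I :: complex
      by simp
    from this[of "sqrt (2 * pi)"] show ?thesis
      unfolding of_real_mult[of "sqrt (2 * pi)"] using e by (simp del: of_real_divide)
  qed
  have a: "sqrt a > 0" using assms by simp
  have "of_real (sqrt (2 * pi) * exp (- ((s / sqrt a)\<^sup>2 / 2))) = (LINT t|lborel. exp (\<i> * of_real (s / sqrt a * t) - of_real (t\<^sup>2 / 2)))"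
    by (rule std[symmetric])
  also have "\<dots> = \<bar>sqrt a\<bar> *\<^sub>R (LINT t|lborel. exp (\<i> * of_real (s / sqrt a * (0 + sqrt a * t)) - of_real ((0 + sqrt a * t)\<^sup>2 / 2)))"
    using a by (intro lborel_integral_real_affine) auto
  also have "\<dots> = sqrt a *\<^sub>R (LINT t|lborel. exp (\<i> * of_real (s * t) - of_real (a * t\<^sup>2 / 2)))"
    using a assms by (simp add: power_mult_distrib)
  finally have "(LINT t|lborel. exp (\<i> * of_real (s * t) - of_real (a * t\<^sup>2 / 2)))
      = (1 / sqrt a) *\<^sub>R of_real (sqrt (2 * pi) * exp (- ((s / sqrt a)\<^sup>2 / 2)))"
    using a by simp
  then show ?thesis
    using assms by (simp add: scaleR_conv_of_real real_sqrt_divide power_divide mult.commute)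
qed

section \<open>Gaussian wave packets\<close>

text \<open>
  The spatial frequency \<open>n\<close> oscillates in time with frequency \<open>\<omega> n\<close>, so that \<open>\<omega> n + n\<^sup>2\<close> is its
  modulation: the space-time Fourier transform is concentrated near \<open>\<tau> = \<omega> n\<close>, at distance
  \<open>\<bar>\<omega> n + n\<^sup>2\<bar>\<close> from the parabola \<open>\<tau> = - n\<^sup>2\<close>.  The Gaussian keeps all transforms explicit.
\<close>

definition wave_packet :: "int set \<Rightarrow> (int \<Rightarrow> real) \<Rightarrow> (int \<Rightarrow> real) \<Rightarrow> real \<Rightarrow> real \<Rightarrow> complex" where
  "wave_packet A c \<omega> t x =
     (\<Sum>n\<in>A. of_real (c n) * exp (\<i> * of_real (\<omega> n * t) - of_real (t\<^sup>2 / 2)) * exp (\<i> * of_real x * of_int n))"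

lemma polynomial_gaussian_bounded: "\<exists>B. \<forall>t::real. \<bar>t\<bar> ^ N * (cmod (poly Q (of_real t)) * exp (- (t\<^sup>2 / 2))) \<le> B"
proof (induction Q arbitrary: N)
  case 0
  then show ?case by auto
next
  case (pCons a Q)
  have mono: "\<bar>t\<bar> ^ N * exp (- (t\<^sup>2 / 2)) \<le> 1 + 2 ^ N * fact N" for t :: real
  proof -
    have 1: "\<bar>t\<bar> ^ N \<le> 1 + \<bar>t\<bar> ^ (2 * N)"
    proof (cases "\<bar>t\<bar> \<le> 1")
      case True
      then show ?thesis using power_le_one[of "\<bar>t\<bar>" N] by (simp add: add_increasing2)
    next
      case False
      then show ?thesis using power_increasing[of N "2 * N" "\<bar>t\<bar>"] by (simp add: add_increasing)
    qed
    have 2: "(t\<^sup>2 / 2) ^ N / fact N \<le> exp (t\<^sup>2 / 2)"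
    proof -
      have "(\<Sum>i\<in>{N}. (t\<^sup>2 / 2) ^ i /\<^sub>R fact i) \<le> (\<Sum>i. (t\<^sup>2 / 2) ^ i /\<^sub>R fact i)"
        by (rule sum_le_suminf[OF summable_exp_generic]) auto
      moreover have "(t\<^sup>2 / 2) ^ N / fact N = (t\<^sup>2 / 2) ^ N /\<^sub>R fact N"
        unfolding real_scaleR_def by (rule divide_inverse_commute)
      ultimately show ?thesis unfolding exp_def by (simp only: sum.insert_remove sum.empty finite.intros empty_Diff add_0_right)
    qed
    have 3: "\<bar>t\<bar> ^ (2 * N) = 2 ^ N * fact N * ((t\<^sup>2 / 2) ^ N / fact N)"
      by (simp add: power_mult power_divide)
    have 4: "\<bar>t\<bar> ^ (2 * N) \<le> 2 ^ N * fact N * exp (t\<^sup>2 / 2)"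
      unfolding 3 by (intro mult_left_mono 2) auto
    have "1 \<le> exp (t\<^sup>2 / 2)" by simp
    then have "\<bar>t\<bar> ^ N \<le> (1 + 2 ^ N * fact N) * exp (t\<^sup>2 / 2)"
      using 1 4 unfolding distrib_right by linarith
    then have "\<bar>t\<bar> ^ N * exp (- (t\<^sup>2 / 2)) \<le> (1 + 2 ^ N * fact N) * exp (t\<^sup>2 / 2) * exp (- (t\<^sup>2 / 2))"
      by (rule mult_right_mono) simp
    also have "\<dots> = 1 + 2 ^ N * fact N"
      unfolding mult.assoc exp_add[symmetric] by simp
    finally show ?thesis .
  qed
  obtain B where B: "\<And>t::real. \<bar>t\<bar> ^ Suc N * (cmod (poly Q (of_real t)) * exp (- (t\<^sup>2 / 2))) \<le> B"
    using pCons.IH[of "Suc N"] by blast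
  have "\<bar>t\<bar> ^ N * (cmod (poly (pCons a Q) (of_real t)) * exp (- (t\<^sup>2 / 2))) \<le> cmod a * (1 + 2 ^ N * fact N) + B" for t
  proof -
    have "cmod (poly (pCons a Q) (of_real t)) \<le> cmod a + \<bar>t\<bar> * cmod (poly Q (of_real t))"
      using norm_triangle_ineq[of a "of_real t * poly Q (of_real t)"] by (simp add: norm_mult)
    then have "\<bar>t\<bar> ^ N * (cmod (poly (pCons a Q) (of_real t)) * exp (- (t\<^sup>2 / 2)))
      \<le> \<bar>t\<bar> ^ N * ((cmod a + \<bar>t\<bar> * cmod (poly Q (of_real t))) * exp (- (t\<^sup>2 / 2)))"
      by (intro mult_left_mono mult_right_mono) auto
    also have "\<dots> = cmod a * (\<bar>t\<bar> ^ N * exp (- (t\<^sup>2 / 2))) + \<bar>t\<bar> ^ Suc N * (cmod (poly Q (of_real t)) * exp (- (t\<^sup>2 / 2)))"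
      by (simp add: algebra_simps)
    also have "\<dots> \<le> cmod a * (1 + 2 ^ N * fact N) + B"
      by (intro add_mono mult_left_mono mono B) auto
    finally show ?thesis .
  qed
  then show ?case by blast
qed

text \<open>
  Every \<open>t\<close>-derivative of a mode is a polynomial times the same mode, with the polynomials generated
  by \<open>Q \<mapsto> Q' + (\<i> \<omega> - t) Q\<close>; the decay is then that of a polynomial times a Gaussian.
\<close>

lemma wave_packet_test_function:
  assumes "finite A"
  shows "wave_packet A c \<omega> \<in> test_functions"
proof -
  define P where "P n j = ((\<lambda>Q. pderiv Q + [:\<i> * of_real (\<omega> n), -1:] * Q) ^^ j) 1" for n j
  define G where "G n z = exp (\<i> * of_real (\<omega> n) * z - z\<^sup>2 / 2)" for n and z :: complex
  define D where "D j k t x = (\<Sum>n\<in>A. of_real (c n) * (poly (P n j) (of_real t) * G n (of_real t))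
      * ((\<i> * of_int n) ^ k * exp (\<i> * of_real x * of_int n)))" for j k and t x :: real
  have G_norm: "cmod (G n (of_real t)) = exp (- (t\<^sup>2 / 2))" for n t
    by (simp add: G_def norm_exp_eq_Re power2_eq_square)
  have dt: "((\<lambda>s. poly (P n j) (of_real s) * G n (of_real s)) has_vector_derivative
      poly (P n (Suc j)) (of_real t) * G n (of_real t)) (at t)" for n j and t :: real
    unfolding G_def
    by (rule has_vector_derivative_real_field)
      (auto intro!: derivative_eq_intros simp: P_def algebra_simps)
  have dx: "((\<lambda>y. (\<i> * of_int n) ^ k * exp (\<i> * of_real y * of_int n)) has_vector_derivative
      (\<i> * of_int n) ^ Suc k * exp (\<i> * of_real x * of_int n)) (at x)" for n k and x :: real
    by (rule has_vector_derivative_real_field)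
      (auto intro!: derivative_eq_intros)
  have "\<exists>B. \<forall>t x. \<bar>t\<bar> ^ N * cmod (D j k t x) \<le> B" for j k N
  proof -
    obtain B where B: "\<And>n t. \<bar>t\<bar> ^ N * (cmod (poly (P n j) (of_real t)) * exp (- (t\<^sup>2 / 2))) \<le> B n"
      using polynomial_gaussian_bounded[of N "P _ j"] by metis
    have "\<bar>t\<bar> ^ N * cmod (D j k t x) \<le> (\<Sum>n\<in>A. \<bar>c n\<bar> * B n * cmod (\<i> * of_int n) ^ k)" for t x
    proof -
      have "\<bar>t\<bar> ^ N * cmod (D j k t x) \<le> \<bar>t\<bar> ^ N * (\<Sum>n\<in>A. \<bar>c n\<bar> * (cmod (poly (P n j) (of_real t)) * exp (- (t\<^sup>2 / 2))) * cmod (\<i> * of_int n) ^ k)"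
        unfolding D_def
        by (intro mult_left_mono order_trans[OF norm_sum] sum_mono)
          (simp_all add: norm_mult norm_power G_norm norm_exp_eq_Re)
      also have "\<dots> = (\<Sum>n\<in>A. \<bar>c n\<bar> * (\<bar>t\<bar> ^ N * (cmod (poly (P n j) (of_real t)) * exp (- (t\<^sup>2 / 2)))) * cmod (\<i> * of_int n) ^ k)"
        by (simp add: sum_distrib_left mult_ac)
      also have "\<dots> \<le> (\<Sum>n\<in>A. \<bar>c n\<bar> * B n * cmod (\<i> * of_int n) ^ k)"
        by (intro sum_mono mult_right_mono mult_left_mono B) auto
      finally show ?thesis .
    qed
    then show ?thesis by blast
  qed
  moreover have "D 0 0 = wave_packet A c \<omega>"
    by (intro ext) (simp add: D_def wave_packet_def P_def G_def mult.assoc)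
  moreover have "continuous_on UNIV (\<lambda>(t, x). D j k t x)" for j k
    unfolding D_def G_def split_beta by (intro continuous_intros) auto
  moreover have "((\<lambda>s. D j k s x) has_vector_derivative D (Suc j) k t x) (at t)" for j k t x
    unfolding D_def
    by (rule has_vector_derivative_sum, rule has_vector_derivative_mult_left, rule has_vector_derivative_mult_right, rule dt)
  moreover have "((\<lambda>y. D j k t y) has_vector_derivative D j (Suc k) t x) (at x)" for j k t x
    unfolding D_def
    by (rule has_vector_derivative_sum, rule has_vector_derivative_mult_right, rule dx)
  moreover have "wave_packet A c \<omega> t (x + 2 * pi) = wave_packet A c \<omega> t x" for t x
  proof -
    have "exp (\<i> * of_real (x + 2 * pi) * of_int n) = exp (\<i> * of_real x * of_int n)" for n
    proof -
      have "exp (\<i> * of_real (2 * pi) * of_int n) = (1 :: complex)"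
        using exp_integer_2pi[of "of_int n"] by (simp add: mult_ac)
      then show ?thesis by (simp add: distrib_left distrib_right exp_add)
    qed
    then show ?thesis by (simp add: wave_packet_def)
  qed
  ultimately show ?thesis unfolding test_functions_def by blast
qed

lemma fourier_x_wave_packet:
  assumes "finite A"
  shows "fourier_x (wave_packet A c \<omega>) t \<xi> =
    (if \<xi> \<in> A then of_real (sqrt (2 * pi)) * (of_real (c \<xi>) * exp (\<i> * of_real (\<omega> \<xi> * t) - of_real (t\<^sup>2 / 2))) else 0)"
  using fourier_x_trig_polynomial[OF assms, of "\<lambda>t n. of_real (c n) * exp (\<i> * of_real (\<omega> n * t) - of_real (t\<^sup>2 / 2))" t \<xi>]
  by (simp add: wave_packet_def[abs_def])

lemma fourier_tx_wave_packet:
  assumes "finite A"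
  shows "fourier_tx (wave_packet A c \<omega>) \<tau> \<xi> =
    (if \<xi> \<in> A then of_real (c \<xi> * sqrt (2 * pi) * exp (- ((\<omega> \<xi> - \<tau>)\<^sup>2 / 2))) else 0)"
proof (cases "\<xi> \<in> A")
  case False
  then show ?thesis using assms by (simp add: fourier_tx_def fourier_x_wave_packet)
next
  case True
  have "fourier_x (wave_packet A c \<omega>) t \<xi> * exp (- (\<i> * of_real t * of_real \<tau>)) =
      of_real (sqrt (2 * pi) * c \<xi>) * exp (\<i> * of_real ((\<omega> \<xi> - \<tau>) * t) - of_real (1 * t\<^sup>2 / 2))" for t
    using True assms by (simp add: fourier_x_wave_packet mult.assoc exp_add[symmetric] algebra_simps)
  then have "fourier_tx (wave_packet A c \<omega>) \<tau> \<xi> = of_real (1 / sqrt (2 * pi)) *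
      (of_real (sqrt (2 * pi) * c \<xi>) * of_real (sqrt (2 * pi / 1) * exp (- ((\<omega> \<xi> - \<tau>)\<^sup>2 / (2 * 1)))))"
    unfolding fourier_tx_def by (simp only: integral_mult_right_zero gaussian_fourier zero_less_one)
  also have "\<dots> = of_real (1 / sqrt (2 * pi) * (sqrt (2 * pi) * c \<xi> * (sqrt (2 * pi) * exp (- ((\<omega> \<xi> - \<tau>)\<^sup>2 / 2)))))"
    by simp
  also have "1 / sqrt (2 * pi) * (sqrt (2 * pi) * c \<xi> * (sqrt (2 * pi) * exp (- ((\<omega> \<xi> - \<tau>)\<^sup>2 / 2))))
      = c \<xi> * sqrt (2 * pi) * exp (- ((\<omega> \<xi> - \<tau>)\<^sup>2 / 2))"
    by (simp add: field_simps)
  finally show ?thesis using True by simp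
qed

section \<open>Norms of wave packets\<close>

lemma jbracket_le: "jbracket y \<le> 1 + \<bar>y\<bar>"
  unfolding jbracket_def by (rule real_le_lsqrt) (auto simp: power2_eq_square algebra_simps)

lemma jbracket_ge_1: "1 \<le> jbracket y"
  unfolding jbracket_def by simp

lemma nn_integral_gaussian: "(\<integral>\<^sup>+ \<tau>. ennreal (exp (- ((w - \<tau>)\<^sup>2 / 4))) \<partial>lborel) = ennreal (2 * sqrt pi)"
proof -
  have eq: "exp (- ((w - \<tau>)\<^sup>2 / 4)) = (2 * sqrt pi) * normal_density w (sqrt 2) \<tau>" for \<tau>
    by (simp add: normal_density_def real_sqrt_mult power2_commute)
  have "(\<integral>\<^sup>+ \<tau>. ennreal (normal_density w (sqrt 2) \<tau>) \<partial>lborel) = 1"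
    using nn_integral_eq_integral[OF integrable_normal_density[of "sqrt 2" w]] by simp
  then show ?thesis
    unfolding eq by (simp add: ennreal_mult nn_integral_cmult)
qed

lemma jbracket_add_powr_half_le:
  "jbracket (y + v) powr (1 / 2) \<le> (1 + \<bar>y\<bar>) powr (1 / 2) * (1 + \<bar>v\<bar>) powr (1 / 2)"
proof -
  have "1 + \<bar>y + v\<bar> \<le> (1 + \<bar>y\<bar>) * (1 + \<bar>v\<bar>)"
  proof -
    have "(1 + \<bar>y\<bar>) * (1 + \<bar>v\<bar>) = 1 + \<bar>y\<bar> + \<bar>v\<bar> + \<bar>y\<bar> * \<bar>v\<bar>"
      by (simp add: algebra_simps)
    moreover have "0 \<le> \<bar>y\<bar> * \<bar>v\<bar>" by simp
    ultimately show ?thesis using abs_triangle_ineq[of y v] by linarith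
  qed
  then have "jbracket (y + v) \<le> (1 + \<bar>y\<bar>) * (1 + \<bar>v\<bar>)"
    using jbracket_le[of "y + v"] by (rule order_trans[rotated])
  then have "jbracket (y + v) powr (1 / 2) \<le> ((1 + \<bar>y\<bar>) * (1 + \<bar>v\<bar>)) powr (1 / 2)"
    using jbracket_ge_1[of "y + v"] by (intro powr_mono2) auto
  then show ?thesis by (simp only: powr_mult)
qed

lemma powr_half_gaussian_le:
  fixes y :: real
  shows "(1 + \<bar>y\<bar>) powr (1 / 2) * exp (- (y\<^sup>2 / 2)) \<le> 2 * exp (- (y\<^sup>2 / 4))"
proof -
  have "(1 + \<bar>y\<bar>) powr (1 / 2) \<le> (1 + \<bar>y\<bar>) powr 1" by (intro powr_mono) auto
  also have "\<dots> \<le> 2 * (1 + y\<^sup>2 / 4)"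
    using zero_le_power2[of "\<bar>y\<bar> - 1"] by (simp add: power2_eq_square algebra_simps)
  also have "\<dots> \<le> 2 * exp (y\<^sup>2 / 4)" by (intro mult_left_mono exp_ge_add_one_self) auto
  finally have "(1 + \<bar>y\<bar>) powr (1 / 2) * exp (- (y\<^sup>2 / 2)) \<le> 2 * exp (y\<^sup>2 / 4) * exp (- (y\<^sup>2 / 2))"
    by (rule mult_right_mono) simp
  also have "\<dots> = 2 * exp (- (y\<^sup>2 / 4))" unfolding mult.assoc exp_add[symmetric] by simp
  finally show ?thesis .
qed

text \<open>
  Away from \<open>\<tau> = \<omega> \<xi>\<close> the modulation weight gains only a factor \<open>(1 + \<bar>\<tau> - \<omega> \<xi>\<bar>)\<^bsup>1/2\<^esup>\<close>, which the
  Gaussian absorbs; the modulation thus costs, up to a constant, no more than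
  the weight at the centre.
\<close>

lemma wave_packet_mode_norm_le:
  assumes A: "finite A" and "0 \<le> L" and q: "1 \<le> q" and \<xi>: "\<xi> \<in> A" and "0 \<le> a"
    and bound: "\<bar>c \<xi>\<bar> * jbracket (of_int \<xi>) powr (1 / 2) * (1 + \<bar>\<omega> \<xi> + (of_int \<xi>)\<^sup>2\<bar>) powr (1 / 2) \<le> L * a"
  shows "Lp_norm lborel (dual_exponent q) (\<lambda>\<tau>. ennreal (jbracket (\<tau> + (of_int \<xi>)\<^sup>2) powr (1 / 2) *
        jbracket (of_int \<xi>) powr (1 / 2) * cmod (fourier_tx (wave_packet A c \<omega>) \<tau> \<xi>)))
      \<le> ennreal (4 * sqrt (2 * pi) * sqrt pi * L * a)"
proof -
  have "Lp_norm lborel (dual_exponent q) (\<lambda>\<tau>. ennreal (jbracket (\<tau> + (of_int \<xi>)\<^sup>2) powr (1 / 2) *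
      jbracket (of_int \<xi>) powr (1 / 2) * cmod (fourier_tx (wave_packet A c \<omega>) \<tau> \<xi>)))
    \<le> ennreal (2 * sqrt (2 * pi) * (L * a) * (2 * sqrt pi) powr (1 / 1))"
  proof (rule Lp_norm_le[where g = "\<lambda>\<tau>. exp (- ((\<omega> \<xi> - \<tau>)\<^sup>2 / 4))"])
    fix \<tau>
    define y where "y = \<tau> - \<omega> \<xi>"
    define v where "v = \<omega> \<xi> + (of_int \<xi>)\<^sup>2"
    have jb: "jbracket (\<tau> + (of_int \<xi>)\<^sup>2) powr (1 / 2) \<le> (1 + \<bar>y\<bar>) powr (1 / 2) * (1 + \<bar>v\<bar>) powr (1 / 2)"
      using jbracket_add_powr_half_le[of y v] by (simp add: y_def v_def)
    have "jbracket (\<tau> + (of_int \<xi>)\<^sup>2) powr (1 / 2) *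
        jbracket (of_int \<xi>) powr (1 / 2) * cmod (fourier_tx (wave_packet A c \<omega>) \<tau> \<xi>)
      = jbracket (\<tau> + (of_int \<xi>)\<^sup>2) powr (1 / 2) *
        (jbracket (of_int \<xi>) powr (1 / 2) * (\<bar>c \<xi>\<bar> * sqrt (2 * pi) * exp (- (y\<^sup>2 / 2))))"
      using \<xi> A unfolding fourier_tx_wave_packet[OF A] y_def
      by (simp only: if_True norm_of_real abs_mult power2_commute[of \<tau>] mult.assoc) simp
    also have "\<dots> \<le> ((1 + \<bar>y\<bar>) powr (1 / 2) * (1 + \<bar>v\<bar>) powr (1 / 2)) *
        (jbracket (of_int \<xi>) powr (1 / 2) * (\<bar>c \<xi>\<bar> * sqrt (2 * pi) * exp (- (y\<^sup>2 / 2))))"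
      by (intro mult_right_mono jb) auto
    also have "\<dots> = (\<bar>c \<xi>\<bar> * jbracket (of_int \<xi>) powr (1 / 2) * (1 + \<bar>v\<bar>) powr (1 / 2)) *
        (sqrt (2 * pi) * ((1 + \<bar>y\<bar>) powr (1 / 2) * exp (- (y\<^sup>2 / 2))))"
      by (simp only: mult_ac)
    also have "\<dots> \<le> (L * a) * (sqrt (2 * pi) * (2 * exp (- (y\<^sup>2 / 4))))"
    proof (rule mult_mono)
      show "sqrt (2 * pi) * ((1 + \<bar>y\<bar>) powr (1 / 2) * exp (- (y\<^sup>2 / 2))) \<le> sqrt (2 * pi) * (2 * exp (- (y\<^sup>2 / 4)))"
        by (intro mult_left_mono powr_half_gaussian_le) simp
    qed (use bound \<open>0 \<le> a\<close> \<open>0 \<le> L\<close> in \<open>auto simp: v_def\<close>)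
    also have "\<dots> = 2 * sqrt (2 * pi) * (L * a) * exp (- ((\<omega> \<xi> - \<tau>)\<^sup>2 / 4))"
      by (simp add: y_def power2_commute)
    finally show "ennreal (jbracket (\<tau> + (of_int \<xi>)\<^sup>2) powr (1 / 2) *
        jbracket (of_int \<xi>) powr (1 / 2) * cmod (fourier_tx (wave_packet A c \<omega>) \<tau> \<xi>))
      \<le> ennreal (2 * sqrt (2 * pi) * (L * a) * exp (- ((\<omega> \<xi> - \<tau>)\<^sup>2 / 4)))"
      by (rule ennreal_leI)
  next
    show "(\<lambda>\<tau>. ennreal (jbracket (\<tau> + (of_int \<xi>)\<^sup>2) powr (1 / 2) *
        jbracket (of_int \<xi>) powr (1 / 2) * cmod (fourier_tx (wave_packet A c \<omega>) \<tau> \<xi>))) \<in> borel_measurable lborel"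
      unfolding fourier_tx_wave_packet[OF A] by measurable
    have "1 \<le> sqrt pi" using pi_gt3 by (simp add: real_le_rsqrt)
    then show "1 \<le> 2 * sqrt pi" by linarith
  qed (use q \<open>0 \<le> a\<close> \<open>0 \<le> L\<close> in \<open>auto simp: nn_integral_gaussian dual_exponent_ge_1\<close>)
  also have "\<dots> = ennreal (4 * sqrt (2 * pi) * sqrt pi * L * a)"
    by (simp add: mult_ac)
  finally show ?thesis .
qed

text \<open>
  Up to a constant the norm of a packet is at most the sequence norm of
  \<open>\<bar>c n\<bar> * \<langle>n\<rangle>\<^bsup>1/2\<^esup> * (1 + \<bar>\<omega> n + n\<^sup>2\<bar>)\<^bsup>1/2\<^esup>\<close>.  The bound is uniform in both exponents because a sequence
  \<open>g \<le> 1\<close> with \<open>\<Sum> g\<^sup>4 \<le> H\<close>, \<open>H \<ge> 1\<close>, has norm at most \<open>H\<^bsup>1/4\<^esup>\<close> for every exponent at least 4.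
\<close>

lemma X_prenorm_wave_packet_le:
  assumes A: "finite A" and "0 \<le> L" "1 \<le> H" and r: "ennreal 4 \<le> dual_exponent r" and q: "1 \<le> q"
    and g: "\<And>n. n \<in> A \<Longrightarrow> 0 \<le> g n" "\<And>n. n \<in> A \<Longrightarrow> g n \<le> 1"
    and bound: "\<And>n. n \<in> A \<Longrightarrow>
      \<bar>c n\<bar> * jbracket (of_int n) powr (1 / 2) * (1 + \<bar>\<omega> n + (of_int n)\<^sup>2\<bar>) powr (1 / 2) \<le> L * g n"
    and sum: "(\<Sum>n\<in>A. g n powr 4) \<le> H"
  shows "X_prenorm (1 / 2) (1 / 2) r q (wave_packet A c \<omega>)
    \<le> ennreal (4 * sqrt (2 * pi) * sqrt pi * L * H powr (1 / 4))"
proof -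
  define g' where "g' n = (if n \<in> A then g n else 0)" for n
  have inner: "Lp_norm lborel (dual_exponent q) (\<lambda>\<tau>. ennreal (jbracket (\<tau> + (of_int \<xi>)\<^sup>2) powr (1 / 2) *
      jbracket (of_int \<xi>) powr (1 / 2) * cmod (fourier_tx (wave_packet A c \<omega>) \<tau> \<xi>)))
    \<le> ennreal (4 * sqrt (2 * pi) * sqrt pi * L * g' \<xi>)" for \<xi>
  proof (cases "\<xi> \<in> A")
    case False
    then show ?thesis using A Lp_norm_0[OF dual_exponent_ge_1[OF q]]
      by (simp add: fourier_tx_wave_packet g'_def)
  next
    case True
    then show ?thesis
      unfolding g'_def using wave_packet_mode_norm_le[where c = c and \<omega> = \<omega>, OF A assms(2) q True g(1)[OF True] bound[OF True]] by simp
  qed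
  show ?thesis
    unfolding X_prenorm_def
  proof (rule Lp_norm_le[where g = g'])
    have "(\<integral>\<^sup>+ n. ennreal (g' n powr 4) \<partial>count_space UNIV) = (\<Sum>n\<in>A. ennreal (g' n powr 4))"
      using A by (intro nn_integral_count_space') (auto simp: g'_def)
    also have "\<dots> = ennreal (\<Sum>n\<in>A. g n powr 4)"
      by (simp add: g'_def)
    finally show "(\<integral>\<^sup>+ n. ennreal (g' n powr 4) \<partial>count_space UNIV) \<le> ennreal H"
      using sum by (simp add: ennreal_leI)
    show "0 \<le> g' n" "g' n \<le> 1" for n
      using g by (simp_all add: g'_def)
    show "0 \<le> 4 * sqrt (2 * pi) * sqrt pi * L"
      using \<open>0 \<le> L\<close> by simp
  qed (use inner \<open>1 \<le> H\<close> r in simp_all)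
qed

section \<open>The trilinear operator on finitely many frequencies\<close>

text \<open>
  With finitely many input frequencies the Fourier series that defines \<open>T_op\<close> is a trigonometric
  polynomial, so its coefficients can be read off.
\<close>

lemma fourier_x_T_op:
  assumes "finite A1" "finite A2" "finite A3"
    and supp: "\<And>n. n \<notin> A1 \<Longrightarrow> fourier_x u1 t n = 0" "\<And>n. n \<notin> A2 \<Longrightarrow> fourier_x u2 t n = 0"
      "\<And>n. n \<notin> A3 \<Longrightarrow> fourier_x u3 t n = 0"
  shows "fourier_x (T_op u1 u2 u3) t \<xi> = T_hat u1 u2 u3 t \<xi>"
proof -
  define B where "B = (\<lambda>(a, b, c). a + b - c) ` (A1 \<times> A2 \<times> A3)"
  have B: "finite B" using assms by (simp add: B_def)
  have supp3: "fourier_x (\<lambda>t x. cnj (u3 t x)) t n = 0" if "- n \<notin> A3" for n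
    using supp(3)[OF that] by (simp add: fourier_x_cnj)
  have inB: "\<eta> \<in> B" if "n1 \<in> A1" "n2 \<in> A2" "- n3 \<in> A3" "\<eta> = n1 + n2 + n3" for \<eta> n1 n2 n3
    unfolding B_def using that by (intro image_eqI[of _ _ "(n1, n2, - n3)"]) auto
  have zero: "T_hat u1 u2 u3 t \<eta> = 0" if "\<eta> \<notin> B" for \<eta>
  proof -
    have Z1: "fourier_x u1 t n1 * fourier_x u2 t n2 * (\<i> * of_int (\<eta> - n1 - n2)) *
        fourier_x (\<lambda>t x. cnj (u3 t x)) t (\<eta> - n1 - n2) = 0" for n1 n2
      using inB[of n1 n2 "\<eta> - n1 - n2" \<eta>] that supp(1)[of n1] supp(2)[of n2] supp3[of "\<eta> - n1 - n2"] by auto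
    have Z2: "fourier_x u1 t \<eta> * fourier_x u2 t \<eta> * (\<i> * of_int \<eta>) *
        fourier_x (\<lambda>t x. cnj (u3 t x)) t (- \<eta>) = 0"
      using inB[of \<eta> \<eta> "- \<eta>" \<eta>] that supp(1)[of \<eta>] supp(2)[of \<eta>] supp3[of "- \<eta>"] by auto
    show ?thesis unfolding T_hat_def Z1 Z2 by (simp add: case_prod_unfold)
  qed
  have "T_op u1 u2 u3 t x = (\<Sum>n\<in>B. of_real (1 / sqrt (2 * pi)) * T_hat u1 u2 u3 t n * exp (\<i> * of_real x * of_int n))" for x
  proof -
    have "(\<Sum>\<^sub>\<infinity>n\<in>UNIV. T_hat u1 u2 u3 t n * exp (\<i> * of_real x * of_int n))
        = (\<Sum>\<^sub>\<infinity>n\<in>B. T_hat u1 u2 u3 t n * exp (\<i> * of_real x * of_int n))"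
      using zero by (intro infsum_cong_neutral) auto
    also have "\<dots> = (\<Sum>n\<in>B. T_hat u1 u2 u3 t n * exp (\<i> * of_real x * of_int n))"
      using B by (rule infsum_finite)
    finally show ?thesis by (simp only: T_op_def sum_distrib_left mult.assoc)
  qed
  then have "fourier_x (T_op u1 u2 u3) t \<xi> = fourier_x (\<lambda>t' x. \<Sum>n\<in>B. of_real (1 / sqrt (2 * pi)) * T_hat u1 u2 u3 t n * exp (\<i> * of_real x * of_int n)) t \<xi>"
    by (simp add: fourier_x_def)
  also have "\<dots> = (if \<xi> \<in> B then of_real (sqrt (2 * pi)) * (of_real (1 / sqrt (2 * pi)) * T_hat u1 u2 u3 t \<xi>) else 0)"
    using B by (rule fourier_x_trig_polynomial)
  also have "\<dots> = T_hat u1 u2 u3 t \<xi>"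
    using zero by simp
  finally show ?thesis .
qed

section \<open>The counterexample\<close>

text \<open>
  The input \<open>high_input\<close> carries the whole modulation: its frequencies \<open>n\<close> lie at distance \<open>2 n\<close> from
  the parabola, exactly the value of \<open>\<xi>\<^sup>2 - \<xi>1\<^sup>2 - \<xi>2\<^sup>2 + \<xi>3\<^sup>2 = 2 (\<xi> - \<xi>1) (\<xi> - \<xi>2)\<close> at \<open>\<xi> = 0\<close>, \<open>\<xi>1 = n\<close>, \<open>\<xi>2 = 1\<close>,
  \<open>\<xi>3 = - n - 1\<close>.  The other two inputs and the output lie on the parabola.  The amplitudes
  compensate the weights, \<open>n\<^bsup>1/2\<^esup> * n\<^bsup>1/2\<^esup>\<close> for the first and \<open>n\<^bsup>1/2\<^esup>\<close> for the third input, up to the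
  critical factor \<open>n\<^bsup>-1/4\<^esup>\<close>.  The frequencies of \<open>conjugated_input\<close> are shifted by one so that its
  complex conjugate has frequency \<open>- n - 1\<close>.
\<close>

definition high_input :: "nat \<Rightarrow> real \<Rightarrow> real \<Rightarrow> complex" where
  "high_input N = wave_packet {1..int N} (\<lambda>n. of_int n powr (- 5 / 4)) (\<lambda>n. - (of_int n)\<^sup>2 - 2 * of_int n)"

definition unit_input :: "real \<Rightarrow> real \<Rightarrow> complex" where
  "unit_input = wave_packet {1} (\<lambda>_. 1) (\<lambda>_. - 1)"

definition conjugated_input :: "nat \<Rightarrow> real \<Rightarrow> real \<Rightarrow> complex" where
  "conjugated_input N = wave_packet {2..int N + 1} (\<lambda>n. (of_int n - 1) powr (- 3 / 4)) (\<lambda>n. - (of_int n)\<^sup>2)"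

definition resonant_sum :: "nat \<Rightarrow> real" where
  "resonant_sum N = (\<Sum>n\<in>{1..int N}. (of_int n + 1) / (of_int n)\<^sup>2)"

text \<open>
  The phases of the three factors cancel for every \<open>n\<close>, so that all interactions add up in the same
  function of time.  The frequency \<open>- n - 1\<close> of the derivative together with the amplitudes
  \<open>n\<^bsup>-5/4\<^esup> * n\<^bsup>-3/4\<^esup>\<close> gives terms of size \<open>1 / n\<close>.
\<close>

lemma T_hat_inputs:
  "T_hat (high_input N) unit_input (conjugated_input N) t 0
    = - \<i> * of_real (sqrt (2 * pi) * resonant_sum N) * of_real (exp (- (3 * t\<^sup>2 / 2)))"
proof -
  define R where "R = sqrt (2 * pi)"
  have R: "0 < R" "R * R = 2 * pi" by (simp_all add: R_def)
  let ?A = "{1..int N}"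
  let ?f = "\<lambda>(n1, n2). fourier_x (high_input N) t n1 * fourier_x unit_input t n2 *
          (\<i> * of_int (0 - n1 - n2)) * fourier_x (\<lambda>t x. cnj (conjugated_input N t x)) t (0 - n1 - n2)"
  have "(\<Sum>\<^sub>\<infinity>p\<in>{(n1, n2). n1 \<noteq> 0 \<and> n2 \<noteq> 0}. ?f p) = (\<Sum>\<^sub>\<infinity>p\<in>(\<lambda>n. (n, 1)) ` ?A. ?f p)"
    by (rule infsum_cong_neutral) (auto simp: high_input_def unit_input_def fourier_x_wave_packet image_iff)
  also have "\<dots> = (\<Sum>n\<in>?A. ?f (n, 1))"
    by (subst infsum_finite) (auto simp: sum.reindex inj_on_def)
  also have "\<dots> = (\<Sum>n\<in>?A. - \<i> * of_real (R * R * R * exp (- (3 * t\<^sup>2 / 2)) * ((of_int n + 1) / (of_int n)\<^sup>2)))"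
  proof (rule sum.cong[OF refl])
    fix n assume n: "n \<in> ?A"
    define x where "x = real_of_int n"
    have x: "1 \<le> x" using n by (simp add: x_def)
    define E where "E w = exp (\<i> * of_real (w * t) - of_real (t\<^sup>2 / 2))" for w :: real
    have F1: "fourier_x (high_input N) t n = of_real R * (of_real (x powr (- 5 / 4)) * E (- x\<^sup>2 - 2 * x))"
      using n by (simp add: high_input_def fourier_x_wave_packet R_def E_def x_def)
    have F2: "fourier_x unit_input t 1 = of_real R * E (- 1)"
      by (simp add: unit_input_def fourier_x_wave_packet R_def E_def)
    have F3: "fourier_x (\<lambda>t x. cnj (conjugated_input N t x)) t (0 - n - 1) = of_real R * (of_real (x powr (- 3 / 4)) * cnj (E (- (x + 1)\<^sup>2)))"
      using n by (simp add: fourier_x_cnj conjugated_input_def fourier_x_wave_packet R_def E_def x_def add.commute)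
    have E: "E (- x\<^sup>2 - 2 * x) * E (- 1) * cnj (E (- (x + 1)\<^sup>2)) = of_real (exp (- (3 * t\<^sup>2 / 2)))"
      unfolding E_def exp_cnj exp_add[symmetric] exp_of_real[symmetric]
      by (rule arg_cong[where f = exp]) (simp add: power2_eq_square algebra_simps)
    have P: "x powr (- 5 / 4) * x powr (- 3 / 4) = 1 / x\<^sup>2"
      using x by (simp add: powr_add[symmetric] powr_minus powr_numeral inverse_eq_divide)
    have "?f (n, 1) = of_real (R * R * R) * of_real (x powr (- 5 / 4) * x powr (- 3 / 4)) * (- \<i> * of_real (x + 1))
        * (E (- x\<^sup>2 - 2 * x) * E (- 1) * cnj (E (- (x + 1)\<^sup>2)))"
    proof -
      have "\<i> * of_int (0 - n - 1) = - \<i> * of_real (x + 1)"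
        by (simp add: x_def algebra_simps)
      then show ?thesis unfolding prod.case F1 F2 F3 by (simp only: of_real_mult mult_ac)
    qed
    also have "\<dots> = - \<i> * of_real (R * R * R * exp (- (3 * t\<^sup>2 / 2)) * ((of_int n + 1) / (of_int n)\<^sup>2))"
      unfolding E P by (simp add: x_def)
    finally show "?f (n, 1) = - \<i> * of_real (R * R * R * exp (- (3 * t\<^sup>2 / 2)) * ((of_int n + 1) / (of_int n)\<^sup>2))" .
  qed
  also have "\<dots> = - \<i> * of_real (R * R * R * exp (- (3 * t\<^sup>2 / 2)) * resonant_sum N)"
    by (simp only: resonant_sum_def sum_distrib_left of_real_sum)
  finally have "T_hat (high_input N) unit_input (conjugated_input N) t 0
    = of_real (1 / (2 * pi)) * (- \<i> * of_real (R * R * R * exp (- (3 * t\<^sup>2 / 2)) * resonant_sum N))"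
    by (simp add: T_hat_def)
  also have "\<dots> = - \<i> * of_real (R * resonant_sum N) * of_real (exp (- (3 * t\<^sup>2 / 2)))"
    unfolding R(2) by simp
  finally show ?thesis by (simp add: R_def)
qed

lemma fourier_tx_T_op_inputs:
  "cmod (fourier_tx (T_op (high_input N) unit_input (conjugated_input N)) \<tau> 0)
    = resonant_sum N * sqrt (2 * pi / 3) * exp (- (\<tau>\<^sup>2 / 6))"
proof -
  define w where "w = T_op (high_input N) unit_input (conjugated_input N)"
  have F: "fourier_x w t 0 = - \<i> * of_real (sqrt (2 * pi) * resonant_sum N) * of_real (exp (- (3 * t\<^sup>2 / 2)))" for t
    unfolding w_def T_hat_inputs[symmetric]
    by (rule fourier_x_T_op[of "{1..int N}" "{1}" "{2..int N + 1}"])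
      (auto simp: high_input_def unit_input_def conjugated_input_def fourier_x_wave_packet)
  have "fourier_x w t 0 * exp (- (\<i> * of_real t * of_real \<tau>)) = (- \<i> * of_real (sqrt (2 * pi) * resonant_sum N)) *
      exp (\<i> * of_real (- \<tau> * t) - of_real (3 * t\<^sup>2 / 2))" for t
    unfolding F mult.assoc exp_of_real[symmetric] exp_add[symmetric]
    by (simp add: algebra_simps)
  then have "fourier_tx w \<tau> 0 = of_real (1 / sqrt (2 * pi)) * ((- \<i> * of_real (sqrt (2 * pi) * resonant_sum N)) *
      of_real (sqrt (2 * pi / 3) * exp (- ((- \<tau>)\<^sup>2 / (2 * 3)))))"
    unfolding fourier_tx_def by (simp only: integral_mult_right_zero gaussian_fourier zero_less_numeral)
  then have "cmod (fourier_tx w \<tau> 0) = 1 / sqrt (2 * pi) * (sqrt (2 * pi) * \<bar>resonant_sum N\<bar> * (sqrt (2 * pi / 3) * exp (- (\<tau>\<^sup>2 / 6))))"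
    by (simp only: norm_mult norm_of_real norm_minus_cancel norm_ii abs_mult) simp
  moreover have "0 \<le> resonant_sum N" unfolding resonant_sum_def by (intro sum_nonneg) auto
  ultimately show ?thesis by (simp add: w_def)
qed

lemma harm_int: "harm N = (\<Sum>n\<in>{1..int N}. 1 / real_of_int n)"
proof -
  have "(\<Sum>n\<in>{1..int N}. 1 / real_of_int n) = (\<Sum>k\<in>{1..N}. 1 / real_of_int (int k))"
    by (rule sum.reindex_bij_witness[of _ int nat]) auto
  then show ?thesis by (simp add: harm_def inverse_eq_divide)
qed

lemma harm_le_resonant_sum: "harm N \<le> resonant_sum N"
  unfolding harm_int resonant_sum_def by (intro sum_mono) (auto simp: field_simps power2_eq_square)

text \<open>
  Restricting the norm to the frequency 0 and to \<open>\<tau>\<close> in the unit interval already gives the full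
  growth; there the weight \<open>\<langle>\<tau>\<rangle>\<^bsup>b\<^esup>\<close> is at least \<open>2\<^bsup>b/2\<^esup>\<close> as \<open>b \<le> 0\<close>.
\<close>

lemma X_prenorm_T_op_inputs_ge:
  assumes "b \<le> 0" "1 \<le> r" "1 \<le> p"
  shows "ennreal (sqrt 2 powr b * sqrt (2 * pi / 3) * exp (- (1 / 6)) * harm N)
    \<le> X_prenorm s b r p (T_op (high_input N) unit_input (conjugated_input N))"
proof -
  define \<kappa> where "\<kappa> = sqrt 2 powr b * sqrt (2 * pi / 3) * exp (- (1 / 6))"
  have \<kappa>: "0 \<le> \<kappa>" by (simp add: \<kappa>_def)
  have harm: "0 \<le> (harm N :: real)" by (rule harm_nonneg)
  define I where "I \<xi> = Lp_norm lborel (dual_exponent p) (\<lambda>\<tau>. ennreal (jbracket (\<tau> + (of_int \<xi>)\<^sup>2) powr b *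
      jbracket (of_int \<xi>) powr s * cmod (fourier_tx (T_op (high_input N) unit_input (conjugated_input N)) \<tau> \<xi>)))" for \<xi>
  have le: "ennreal (\<kappa> * harm N) \<le> I 0"
    unfolding I_def fourier_tx_T_op_inputs
  proof (rule Lp_norm_ge[of _ _ "{0..1}"])
    fix \<tau> :: real assume \<tau>: "\<tau> \<in> {0..1}"
    have sq: "\<tau>\<^sup>2 \<le> 1" using \<tau> by (simp add: power_le_one)
    have "jbracket \<tau> \<le> sqrt 2" using sq by (simp add: jbracket_def)
    then have jb: "sqrt 2 powr b \<le> jbracket \<tau> powr b"
      using jbracket_ge_1[of \<tau>] assms by (intro powr_mono2') auto
    have "\<kappa> * harm N = sqrt 2 powr b * (harm N * sqrt (2 * pi / 3) * exp (- (1 / 6)))"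
      by (simp add: \<kappa>_def)
    also have "\<dots> \<le> jbracket \<tau> powr b * (resonant_sum N * sqrt (2 * pi / 3) * exp (- (\<tau>\<^sup>2 / 6)))"
      using sq harm harm_le_resonant_sum[of N] by (intro mult_mono jb) auto
    finally show "ennreal (\<kappa> * harm N) \<le> ennreal (jbracket (\<tau> + (of_int 0)\<^sup>2) powr b *
        jbracket (of_int 0) powr s * (resonant_sum N * sqrt (2 * pi / 3) * exp (- (\<tau>\<^sup>2 / 6))))"
      by (intro ennreal_leI) (simp add: jbracket_def)
  qed (use \<kappa> harm assms in \<open>auto simp: dual_exponent_ge_1\<close>)
  have "ennreal (\<kappa> * harm N) \<le> Lp_norm (count_space UNIV) (dual_exponent r) I"
    by (rule Lp_norm_ge[of _ _ "{0}"]) (use le \<kappa> harm assms in \<open>auto simp: dual_exponent_ge_1\<close>)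
  then show ?thesis
    unfolding X_prenorm_def \<kappa>_def I_def .
qed

lemma powr_quarter_pow_4:
  fixes x :: real
  assumes "0 < x"
  shows "(x powr - (1 / 4)) ^ 4 = 1 / x"
proof -
  have "(x powr - (1 / 4)) ^ 4 = (x powr - (1 / 4)) powr 4" by simp
  also have "\<dots> = x powr - 1" by (simp only: powr_powr) simp
  finally show ?thesis using assms by (simp add: powr_minus_divide)
qed

lemma high_input_norm:
  assumes "1 \<le> N" "ennreal 4 \<le> dual_exponent r" "1 \<le> q"
  shows "X_prenorm (1 / 2) (1 / 2) r q (high_input N) \<le> ennreal (4 * sqrt (2 * pi) * sqrt pi * 3 * harm N powr (1 / 4))"
  unfolding high_input_def
proof (rule X_prenorm_wave_packet_le[where g = "\<lambda>n. of_int n powr (- 1 / 4)"])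
  show "1 \<le> (harm N :: real)" using harm_mono[of 1 N] assms by (simp add: harm_def)
  show "(\<Sum>n\<in>{1..int N}. (real_of_int n powr (- 1 / 4)) powr 4) \<le> harm N"
    unfolding harm_int by (intro sum_mono) (simp add: powr_quarter_pow_4)
next
  fix n assume "n \<in> {1..int N}"
  define x where "x = real_of_int n"
  have x: "1 \<le> x" using \<open>n \<in> _\<close> by (simp add: x_def)
  show "real_of_int n powr (- 1 / 4) \<le> 1"
    using powr_mono[of "- 1 / 4" 0 x] x by (simp add: x_def)
  have "jbracket x \<le> 2 * x" using jbracket_le[of x] x by simp
  then have "jbracket x * (1 + \<bar>- x\<^sup>2 - 2 * x + x\<^sup>2\<bar>) \<le> 2 * x * (3 * x)"
    using x by (intro mult_mono) auto
  also have "\<dots> \<le> (3 * x)\<^sup>2" using x by (simp add: power2_eq_square)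
  finally have le: "jbracket x * (1 + \<bar>- x\<^sup>2 - 2 * x + x\<^sup>2\<bar>) \<le> (3 * x)\<^sup>2" .
  have "(jbracket x * (1 + \<bar>- x\<^sup>2 - 2 * x + x\<^sup>2\<bar>)) powr (1 / 2) \<le> ((3 * x)\<^sup>2) powr (1 / 2)"
    using le jbracket_ge_1[of x] by (intro powr_mono2) auto
  also have "\<dots> = 3 * x" using x by (simp add: powr_half_sqrt real_sqrt_mult power_mult_distrib)
  finally have "x powr (- 5 / 4) * (jbracket x powr (1 / 2) * (1 + \<bar>- x\<^sup>2 - 2 * x + x\<^sup>2\<bar>) powr (1 / 2)) \<le> x powr (- 5 / 4) * (3 * x)"
    unfolding powr_mult by (rule mult_left_mono) simp
  also have "\<dots> = 3 * x powr (- 1 / 4)"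
    using powr_add[of x "- 5 / 4" 1] x by simp
  finally show "\<bar>real_of_int n powr (- 5 / 4)\<bar> * jbracket (real_of_int n) powr (1 / 2) *
      (1 + \<bar>- (real_of_int n)\<^sup>2 - 2 * real_of_int n + (real_of_int n)\<^sup>2\<bar>) powr (1 / 2) \<le> 3 * real_of_int n powr (- 1 / 4)"
    by (simp add: x_def mult.assoc)
qed (use assms in auto)

lemma conjugated_input_norm:
  assumes "1 \<le> N" "ennreal 4 \<le> dual_exponent r" "1 \<le> q"
  shows "X_prenorm (1 / 2) (1 / 2) r q (conjugated_input N) \<le> ennreal (4 * sqrt (2 * pi) * sqrt pi * 3 * harm N powr (1 / 4))"
  unfolding conjugated_input_def
proof (rule X_prenorm_wave_packet_le[where g = "\<lambda>n. (of_int n - 1) powr (- 1 / 4)"])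
  show "1 \<le> (harm N :: real)" using harm_mono[of 1 N] assms by (simp add: harm_def)
  have "(\<Sum>n\<in>{2..int N + 1}. ((real_of_int n - 1) powr (- 1 / 4)) powr 4) = (\<Sum>n\<in>{1..int N}. 1 / real_of_int n)"
    by (rule sum.reindex_bij_witness[of _ "\<lambda>n. n + 1" "\<lambda>n. n - 1"]) (auto simp: powr_quarter_pow_4)
  then show "(\<Sum>n\<in>{2..int N + 1}. ((real_of_int n - 1) powr (- 1 / 4)) powr 4) \<le> harm N"
    by (simp add: harm_int)
next
  fix n assume "n \<in> {2..int N + 1}"
  define x where "x = real_of_int n - 1"
  have x: "1 \<le> x" and n: "real_of_int n = x + 1" using \<open>n \<in> _\<close> by (simp_all add: x_def)
  show "(real_of_int n - 1) powr (- 1 / 4) \<le> 1"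
    using powr_mono[of "- 1 / 4" 0 x] x by (simp add: x_def)
  have "jbracket (x + 1) powr (1 / 2) \<le> (9 * x) powr (1 / 2)"
    using jbracket_le[of "x + 1"] jbracket_ge_1[of "x + 1"] x by (intro powr_mono2) auto
  also have "\<dots> = 3 * x powr (1 / 2)"
    using x by (simp add: powr_half_sqrt real_sqrt_mult)
  finally have "x powr (- 3 / 4) * jbracket (x + 1) powr (1 / 2) \<le> x powr (- 3 / 4) * (3 * x powr (1 / 2))"
    by (rule mult_left_mono) simp
  also have "\<dots> = 3 * x powr (- 1 / 4)"
    using powr_add[of x "- 3 / 4" "1 / 2"] x by simp
  finally show "\<bar>(real_of_int n - 1) powr (- 3 / 4)\<bar> * jbracket (real_of_int n) powr (1 / 2) *
      (1 + \<bar>- (real_of_int n)\<^sup>2 + (real_of_int n)\<^sup>2\<bar>) powr (1 / 2) \<le> 3 * (real_of_int n - 1) powr (- 1 / 4)"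
    by (simp add: n)
qed (use assms in auto)

lemma unit_input_norm:
  assumes "ennreal 4 \<le> dual_exponent r" "1 \<le> q"
  shows "X_prenorm (1 / 2) (1 / 2) r q unit_input \<le> ennreal (4 * sqrt (2 * pi) * sqrt pi * 3 * 1 powr (1 / 4))"
  unfolding unit_input_def
proof (rule X_prenorm_wave_packet_le[where g = "\<lambda>_. 1"])
  have "jbracket 1 powr (1 / 2) \<le> jbracket 1 powr 1"
    using jbracket_ge_1[of 1] by (intro powr_mono) auto
  then show "\<bar>1::real\<bar> * jbracket (real_of_int n) powr (1 / 2) * (1 + \<bar>- 1 + (real_of_int n)\<^sup>2\<bar>) powr (1 / 2) \<le> 3 * 1"
    if "n \<in> {1}" for n
    using that jbracket_le[of 1] jbracket_ge_1[of 1] by simp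
qed (use assms in auto)

theorem mainTheorem3:
  fixes b :: real and r p q :: ennreal
  assumes "b \<le> 0" and "1 \<le> r" and "r \<le> 4 / 3" and "1 \<le> p" and "1 \<le> q"
  shows "\<not> (\<exists>C :: real. T_estimate (1 / 2) (1 / 2) r q (1 / 2) b r p C)"
proof
  assume "\<exists>C :: real. T_estimate (1 / 2) (1 / 2) r q (1 / 2) b r p C"
  then obtain C where T: "T_estimate (1 / 2) (1 / 2) r q (1 / 2) b r p C" by (elim exE)
  have r4: "ennreal 4 \<le> dual_exponent r" using assms by (intro dual_exponent_ge_4)
  define \<kappa> where "\<kappa> = sqrt 2 powr b * sqrt (2 * pi / 3) * exp (- (1 / 6))"
  have \<kappa>: "0 < \<kappa>" by (simp add: \<kappa>_def)
  define K where "K = 4 * sqrt (2 * pi) * sqrt pi * 3"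
  have K: "0 \<le> K" by (simp add: K_def)
  define C' where "C' = max C 0"
  have C': "0 \<le> C'" by (simp add: C'_def)
  have bound: "harm N \<le> (C' * K ^ 3 / \<kappa>)\<^sup>2" if "1 \<le> N" for N
  proof -
    define h where "h = (harm N :: real) powr (1 / 4)"
    have harm: "1 \<le> (harm N :: real)" using harm_mono[of 1 N] that by (simp add: harm_def)
    have h: "0 \<le> h" "h * h = sqrt (harm N)"
      using harm by (simp_all add: h_def powr_add[symmetric] powr_half_sqrt)
    have tests: "high_input N \<in> test_functions" "unit_input \<in> test_functions" "conjugated_input N \<in> test_functions"
      by (simp_all add: high_input_def unit_input_def conjugated_input_def wave_packet_test_function)
    have "ennreal (\<kappa> * harm N) \<le> X_prenorm (1 / 2) b r p (T_op (high_input N) unit_input (conjugated_input N))"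
      unfolding \<kappa>_def using assms by (intro X_prenorm_T_op_inputs_ge)
    also have "\<dots> \<le> ennreal C * X_prenorm (1 / 2) (1 / 2) r q (high_input N) *
        X_prenorm (1 / 2) (1 / 2) r q unit_input * X_prenorm (1 / 2) (1 / 2) r q (conjugated_input N)"
      by (rule T_estimate_test_functions[OF T tests assms(2,5,2,4)])
    also have "\<dots> \<le> ennreal C' * ennreal (K * h) * ennreal K * ennreal (K * h)"
      using high_input_norm[OF that r4 assms(5)] unit_input_norm[OF r4 assms(5)] conjugated_input_norm[OF that r4 assms(5)]
      by (intro mult_mono) (auto simp: K_def h_def C'_def intro: ennreal_leI)
    also have "\<dots> = ennreal (C' * K ^ 3 * (h * h))"
      using K h C' by (simp add: ennreal_mult[symmetric] power3_eq_cube mult_ac)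
    finally have "\<kappa> * harm N \<le> C' * K ^ 3 * sqrt (harm N)"
      using K h harm by (subst (asm) ennreal_le_iff) (auto simp: C'_def)
    moreover have "\<kappa> * harm N = \<kappa> * sqrt (harm N) * sqrt (harm N)"
      unfolding mult.assoc using harm by simp
    ultimately have "\<kappa> * sqrt (harm N) * sqrt (harm N) \<le> C' * K ^ 3 * sqrt (harm N)"
      by simp
    then have "\<kappa> * sqrt (harm N) \<le> C' * K ^ 3"
      using harm that by (subst (asm) mult_le_cancel_right_pos) auto
    then have "sqrt (harm N) \<le> C' * K ^ 3 / \<kappa>"
      using \<kappa> by (simp add: pos_le_divide_eq mult.commute)
    then show ?thesis by (rule sqrt_le_D)
  qed
  have "\<forall>\<^sub>F N in sequentially. harm N > (C' * K ^ 3 / \<kappa>)\<^sup>2"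
    using harm_at_top unfolding filterlim_at_top_dense by blast
  then obtain N where "1 \<le> N" "harm N > (C' * K ^ 3 / \<kappa>)\<^sup>2"
    unfolding eventually_sequentially by (metis le_cases)
  then show False using bound[of N] by simp
qed

end
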